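(* In the curved $4$-body problem in $\mathbb S^3$, the only spherical rectangular positive elliptic equal-mass rotopulsators are the spherical square rotopulsators. The orbit rotates relative to the plane $wx$, but has no rotation with respect to the planes $wy, wz, xy, xz$, and $yz$.
   Context: $\mathbb S^3=\{(w,x,y,z)\in\mathbb R^4: w^2+x^2+y^2+z^2=1\}$, and $\cdot$ is the standard inner product of $\mathbb R^4$. The curved $4$-body problem in $\mathbb S^3$ describes the motion of bodies of masses $m_1,m_2,m_3,m_4>0$ with position vectors ${\bf q}_i=(w_i,x_i,y_i,z_i)$ through the equations $$\ddot{\bf q}_i=\sum_{j=1,\,j\ne i}^4\frac{m_j[{\bf q}_j-({\bf q}_i\cdot{\bf q}_j){\bf q}_i]}{[1-({\bf q}_i\cdot{\bf q}_j)^2]^{3/2}}-(\dot{\bf q}_i\cdot\dot{\bf q}_i){\bf q}_i,\qquad i=1,2,3,4,$$ with initial constraints $({\bf q}_i\cdot{\bf q}_i)(0)=1$, $({\bf q}_i\cdot\dot{\bf q}_i)(0)=0$. Equal-mass means $m_1=m_2=m_3=m_4=:m>0$. The total angular momentum $\sum_{i=1}^4 m_i{\bf q}_i\wedge\dot{\bf q}_i={\bf c}=(c_{wx},c_{wy},c_{wz},c_{xy},c_{xz},c_{yz})$, where $\wedge$ is the wedge product, is a constant of motion; each component measures the rotation of the system about the origin relative to the plane given by its indices, so that having no rotation with respect to a plane means that the corresponding component is zero. Rotopulsators are systems that rotate and change size. A positive elliptic rotopulsator in $\mathbb S^3$ is one that has one elliptic rotation, i.e. a solution of the form $$w_i=r_i\cos(\alpha+a_i),\quad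 x_i=r_i\sin(\alpha+a_i),\quad y_i=y_i(t),\quad z_i=z_i(t),\qquad i=1,2,3,4,$$ where the $a_i$ are constants, $\alpha=\alpha(t)$ is a nonconstant function, and $r_i=r_i(t)\ge 0$, $y_i$, $z_i$ are functions with $r_i^2+y_i^2+z_i^2=1$. Such a rotopulsator is spherical rectangular if the four bodies form a spherical rectangle, i.e. an equiangular spherical quadrilateral, all along the motion; it is a spherical square rotopulsator if this quadrilateral is equiangular and equilateral.
   Formalization: Motions are required to exist for all times (non-square rectangles (r cos α, r sin α, ±y, ±z) exist up to a collision), and "one elliptic rotation" means none also in the plane yz (otherwise c_yz may be nonzero); quadrilaterals are nondegenerate and convex. *)

theory Defs
  imports "HOL-Analysis.Analysis"
begin

text \<open>
  Points of \<open>\<real>\<^sup>4\<close> have coordinates \<open>(w, x, y, z) = (p $ 1, p $ 2, p $ 3, p $ 4)\<close>. The four bodies are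
  indexed by the type \<open>4\<close>, whose arithmetic is modulo 4 (so \<open>4 = 0\<close>); hence \<open>i + 1\<close> is the
  cyclic successor of \<open>i\<close>, which gives the cyclic order of the vertices of a quadrilateral.
\<close>

definition tangent_part :: "real ^ 4 \<Rightarrow> real ^ 4 \<Rightarrow> real ^ 4" where
  "tangent_part p b = b - (p \<bullet> b) *\<^sub>R p"

definition curved_force :: "(4 \<Rightarrow> real) \<Rightarrow> (4 \<Rightarrow> real ^ 4) \<Rightarrow> 4 \<Rightarrow> real ^ 4" where
  "curved_force m p i =
     (\<Sum>j\<in>UNIV - {i}. (m j / (1 - (p i \<bullet> p j)\<^sup>2) powr (3 / 2)) *\<^sub>R tangent_part (p i) (p j))"

text \<open>
  Motions are defined for all times. The third clause excludes collisions and antipodal pairs,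
  where the equations are singular (and where division by zero would otherwise yield 0).
\<close>

definition curved_4body_solution ::
  "(4 \<Rightarrow> real) \<Rightarrow> (4 \<Rightarrow> real \<Rightarrow> real ^ 4) \<Rightarrow> (4 \<Rightarrow> real \<Rightarrow> real ^ 4) \<Rightarrow> bool" where
  "curved_4body_solution m q v \<longleftrightarrow>
     (\<forall>i. m i > 0) \<and>
     (\<forall>i. q i 0 \<bullet> q i 0 = 1 \<and> q i 0 \<bullet> v i 0 = 0) \<and>
     (\<forall>t i j. i \<noteq> j \<longrightarrow> (q i t \<bullet> q j t)\<^sup>2 \<noteq> 1) \<and>
     (\<forall>t i. (q i has_vector_derivative v i t) (at t) \<and>
            (v i has_vector_derivative
               (curved_force m (\<lambda>j. q j t) i - (v i t \<bullet> v i t) *\<^sub>R q i t)) (at t))"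

text \<open>The component of \<open>\<Sum>i. m\<^sub>i q\<^sub>i \<and> v\<^sub>i\<close> belonging to the plane of the coordinates \<open>j\<close>, \<open>k\<close>.\<close>

definition angular_momentum ::
  "(4 \<Rightarrow> real) \<Rightarrow> (4 \<Rightarrow> real ^ 4) \<Rightarrow> (4 \<Rightarrow> real ^ 4) \<Rightarrow> 4 \<Rightarrow> 4 \<Rightarrow> real" where
  "angular_momentum m p u j k = (\<Sum>i\<in>UNIV. m i * (p i $ j * u i $ k - p i $ k * u i $ j))"

definition elliptic_rotation :: "(4 \<Rightarrow> real \<Rightarrow> real ^ 4) \<Rightarrow> 4 \<Rightarrow> 4 \<Rightarrow> bool" where
  "elliptic_rotation q j k \<longleftrightarrow>
     (\<exists>\<alpha> a r. continuous_on UNIV \<alpha> \<and> \<not> \<alpha> constant_on UNIV \<and>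
        (\<forall>i t. r i t \<ge> 0 \<and>
               q i t $ j = r i t * cos (\<alpha> t + a i) \<and>
               q i t $ k = r i t * sin (\<alpha> t + a i)))"

text \<open>
  There is exactly one elliptic rotation, the one in the plane \<open>wx\<close>: motions that also have one in
  the complementary plane \<open>yz\<close> are the positive elliptic-elliptic rotopulsators, a different
  class. Since \<open>r\<^sub>i\<^sup>2 = w\<^sub>i\<^sup>2 + x\<^sub>i\<^sup>2\<close>, the condition \<open>r\<^sub>i\<^sup>2 + y\<^sub>i\<^sup>2 + z\<^sub>i\<^sup>2 = 1\<close> says that \<open>q\<^sub>i\<close> is a unit vector.
\<close>

definition positive_elliptic_rotopulsator ::
  "(4 \<Rightarrow> real) \<Rightarrow> (4 \<Rightarrow> real \<Rightarrow> real ^ 4) \<Rightarrow> (4 \<Rightarrow> real \<Rightarrow> real ^ 4) \<Rightarrow> bool" where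
  "positive_elliptic_rotopulsator m q v \<longleftrightarrow>
     curved_4body_solution m q v \<and>
     (\<forall>i t. norm (q i t) = 1) \<and>
     elliptic_rotation q 1 2 \<and> \<not> elliptic_rotation q 3 4"

text \<open>
  A nondegenerate convex spherical quadrilateral with consecutive vertices \<open>p 1, p 2, p 3, p 4\<close>:
  the vertices span a great 2-sphere, and for each side the other two vertices lie strictly on the
  same side of its great circle. In particular all sides and diagonals are shorter than \<open>\<pi>\<close>,
  and interior angles are the unsigned angles between adjacent sides. A simple quadrilateral on
  a 2-sphere with equal interior angles, not lying on a great circle, is convex or has a convex
  complement.
\<close>

definition spherical_quadrilateral :: "(4 \<Rightarrow> real ^ 4) \<Rightarrow> bool" where
  "spherical_quadrilateral p \<longleftrightarrow>
     (\<forall>i. norm (p i) = 1) \<and>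
     dim (span (range p)) = 3 \<and>
     (\<forall>i. \<exists>h. h \<bullet> p i = 0 \<and> h \<bullet> p (i + 1) = 0 \<and> h \<bullet> p (i + 2) > 0 \<and> h \<bullet> p (i + 3) > 0)"

definition spherical_dist :: "real ^ 4 \<Rightarrow> real ^ 4 \<Rightarrow> real" where
  "spherical_dist a b = arccos (a \<bullet> b)"

text \<open>The angle at \<open>p\<close> between the geodesic arcs from \<open>p\<close> to \<open>a\<close> and from \<open>p\<close> to \<open>b\<close>.\<close>

definition spherical_angle :: "real ^ 4 \<Rightarrow> real ^ 4 \<Rightarrow> real ^ 4 \<Rightarrow> real" where
  "spherical_angle a p b =
     arccos (tangent_part p a \<bullet> tangent_part p b /
             (norm (tangent_part p a) * norm (tangent_part p b)))"

definition equiangular :: "(4 \<Rightarrow> real ^ 4) \<Rightarrow> bool" where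
  "equiangular p \<longleftrightarrow>
     (\<exists>\<theta>. \<forall>i. spherical_angle (p (i - 1)) (p i) (p (i + 1)) = \<theta>)"

definition equilateral :: "(4 \<Rightarrow> real ^ 4) \<Rightarrow> bool" where
  "equilateral p \<longleftrightarrow> (\<exists>s. \<forall>i. spherical_dist (p i) (p (i + 1)) = s)"

definition spherical_rectangle :: "(4 \<Rightarrow> real ^ 4) \<Rightarrow> bool" where
  "spherical_rectangle p \<longleftrightarrow> spherical_quadrilateral p \<and> equiangular p"

definition spherical_square :: "(4 \<Rightarrow> real ^ 4) \<Rightarrow> bool" where
  "spherical_square p \<longleftrightarrow> spherical_quadrilateral p \<and> equiangular p \<and> equilateral p"

definition spherical_rectangular_rotopulsator ::
  "(4 \<Rightarrow> real) \<Rightarrow> (4 \<Rightarrow> real \<Rightarrow> real ^ 4) \<Rightarrow> (4 \<Rightarrow> real \<Rightarrow> real ^ 4) \<Rightarrow> bool" where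
  "spherical_rectangular_rotopulsator m q v \<longleftrightarrow>
     positive_elliptic_rotopulsator m q v \<and> (\<forall>t. spherical_rectangle (\<lambda>i. q i t))"

definition spherical_square_rotopulsator ::
  "(4 \<Rightarrow> real) \<Rightarrow> (4 \<Rightarrow> real \<Rightarrow> real ^ 4) \<Rightarrow> (4 \<Rightarrow> real \<Rightarrow> real ^ 4) \<Rightarrow> bool" where
  "spherical_square_rotopulsator m q v \<longleftrightarrow>
     positive_elliptic_rotopulsator m q v \<and> (\<forall>t. spherical_square (\<lambda>i. q i t))"

end

theory Submission
  imports Defs
begin

text \<open>
  A spherical rectangle satisfies \<open>q\<^sub>1 + q\<^sub>3 = q\<^sub>2 + q\<^sub>4\<close>, so the vertices are \<open>P \<plusminus> U \<plusminus> V\<close> with \<open>P\<close>, \<open>U\<close>, \<open>V\<close>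
  pairwise orthogonal. Equal masses force equal speeds, hence \<open>P'\<close>, \<open>U'\<close>, \<open>V'\<close> are pairwise
  orthogonal as well and each of \<open>P\<close>, \<open>U\<close>, \<open>V\<close> moves in a central field, \<open>X'' = l\<^sub>X X\<close>. Differentiating
  \<open>X' \<bullet> Y' = 0\<close> gives \<open>(l\<^sub>X - l\<^sub>Y) (X \<bullet> Y') = 0\<close>, and \<open>l\<^sub>P > l\<^sub>U, l\<^sub>V\<close>. If \<open>U \<bullet> V' = 0\<close>, then two of \<open>P\<close>, \<open>U\<close>, \<open>V\<close>
  have fixed directions, and attraction excludes this for a motion defined at all times. Otherwise
  \<open>l\<^sub>U = l\<^sub>V\<close>, which means that the rectangle is a square, rotating in the plane of \<open>U\<close> and \<open>V\<close>. The elliptic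
  rotation in \<open>wx\<close> (and the lack of one in \<open>yz\<close>) finally forces this plane to be \<open>wx\<close>, with \<open>P\<close> in a fixed
  direction of \<open>yz\<close>.
\<close>

text \<open>Equal speeds come from the only terms of the equations that do not respect the symmetry
  of the rectangle, the terms \<open>(v i t \<bullet> v i t) *\<^sub>R q i t\<close>: the
  alternating sum of the accelerations vanishes, the forces cancel in it, and the independence of
  \<open>P\<close>, \<open>U\<close>, \<open>V\<close> leaves equations between the speeds. The gaps
  \<open>l\<^sub>P - l\<^sub>U\<close> and \<open>l\<^sub>P - l\<^sub>V\<close> are twice the sum of
  two pair strengths, hence positive.

  The main obstacle is the weakness of an elliptic rotation: its angle is only continuous and its
  radii may vanish, so the angle cannot be differentiated. The proof works with the areal rates
  \<open>x y' - y x'\<close> of the projected bodies instead. A common angle says that these rates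
  are proportional to the squared radii, so each body carries a known share of the total angular
  momentum in the plane, and that total is constant. Comparing the shares of opposite bodies is what
  ties the plane of rotation of the square to a coordinate plane.\<close>

section \<open>Spherical rectangles\<close>

unbundle cross3_syntax

text \<open>A vector orthogonal to \<open>a\<close> and \<open>b\<close> is a multiple of their
  cross product, so its products with \<open>x\<close> and \<open>y\<close> differ from the two
  triple products by one common factor. This replaces the unspecified witness of convexity by the
  normal of the side.\<close>

lemma cross3_same_side:
  fixes h a b x y :: "real^3"
  assumes "h \<bullet> a = 0" "h \<bullet> b = 0" "h \<bullet> x > 0" "h \<bullet> y > 0" "a \<times> b \<noteq> 0"
  shows "((a \<times> b) \<bullet> x) * ((a \<times> b) \<bullet> y) > 0"
proof -
  define n where "n = a \<times> b"
  have "h \<times> n = 0"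
    using assms(1,2) unfolding n_def
    by (simp add: cross_eq_0 Lagrange)
  then have e: "(h \<bullet> z) * (n \<bullet> n) = (h \<bullet> n) * (n \<bullet> z)" for z
    using dot_cross[of h n z n] by (simp add: inner_commute)
  have nn: "n \<bullet> n > 0" using assms(5) by (simp add: n_def)
  have "0 < ((h \<bullet> x) * (n \<bullet> n)) * ((h \<bullet> y) * (n \<bullet> n))" using assms(3,4) nn by simp
  also have "\<dots> = (h \<bullet> n)\<^sup>2 * ((n \<bullet> x) * (n \<bullet> y))" by (simp only: e) (simp add: power2_eq_square)
  finally show ?thesis unfolding n_def[symmetric]
    by (simp add: zero_less_mult_iff)
qed

text \<open>If \<open>a\<close> and \<open>b\<close> were independent, the vectors orthogonal to
  both would form a line, and two nonzero vectors on a line are not orthogonal.\<close>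

lemma orthogonal_parallel_zero:
  fixes a b x y :: "real^3"
  assumes "x \<noteq> 0" "y \<noteq> 0" "x \<bullet> y = 0" "a \<bullet> x = 0" "a \<bullet> y = 0" "b \<bullet> x = 0" "b \<bullet> y = 0"
  shows "a \<times> b = 0"
proof -
  define c where "c = a \<times> b"
  have par: "z \<times> c = 0" if "a \<bullet> z = 0" "b \<bullet> z = 0" for z
    using that by (simp add: c_def Lagrange inner_commute)
  have e: "(z \<bullet> w) * (c \<bullet> c) = (z \<bullet> c) * (c \<bullet> w)" if "a \<bullet> z = 0" "b \<bullet> z = 0" for z w
    using dot_cross[of z c w c] par[OF that] by (simp add: inner_commute)
  have "(x \<bullet> c) * (c \<bullet> y) = 0" using e[of x y] assms by simp
  then have "x \<bullet> c = 0 \<or> y \<bullet> c = 0" by (auto simp: inner_commute)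
  then show ?thesis using e[of x x] e[of y y] assms by (auto simp: c_def inner_commute)
qed

text \<open>
  The unit normals of the sides form the polar quadrilateral. Equal angles make it a rhombus, so
  \<open>n\<^sub>1 + n\<^sub>3\<close> and \<open>n\<^sub>2 + n\<^sub>4\<close> are both orthogonal to its two (mutually orthogonal) diagonals, and
  their cross product is a multiple of \<open>p\<^sub>1 - p\<^sub>2 + p\<^sub>3 - p\<^sub>4\<close>.
\<close>

lemma equiangular_diagonals_R3:
  fixes p1 p2 p3 p4 :: "real^3"
  defines "ang \<equiv> \<lambda>(a::real^3) p b. (a \<bullet> b - (p \<bullet> a) * (p \<bullet> b)) / (sqrt (1 - (p \<bullet> a)\<^sup>2) * sqrt (1 - (p \<bullet> b)\<^sup>2))"
  assumes unit: "p1 \<bullet> p1 = 1" "p2 \<bullet> p2 = 1" "p3 \<bullet> p3 = 1" "p4 \<bullet> p4 = 1"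
    and sides: "(p1 \<bullet> p2)\<^sup>2 < 1" "(p2 \<bullet> p3)\<^sup>2 < 1" "(p3 \<bullet> p4)\<^sup>2 < 1" "(p4 \<bullet> p1)\<^sup>2 < 1"
    and h1: "h1 \<bullet> p1 = 0" "h1 \<bullet> p2 = 0" "h1 \<bullet> p3 > 0" "h1 \<bullet> p4 > 0"
    and h2: "h2 \<bullet> p2 = 0" "h2 \<bullet> p3 = 0" "h2 \<bullet> p4 > 0" "h2 \<bullet> p1 > 0"
    and h3: "h3 \<bullet> p3 = 0" "h3 \<bullet> p4 = 0" "h3 \<bullet> p1 > 0" "h3 \<bullet> p2 > 0"
    and ang: "ang p4 p1 p2 = k" "ang p1 p2 p3 = k" "ang p2 p3 p4 = k" "ang p3 p4 p1 = k"
  shows "p1 + p3 = p2 + p4"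
proof -
  define s where "s = (\<lambda>a b::real^3. sqrt (1 - (a \<bullet> b)\<^sup>2))"
  define n where "n = (\<lambda>a b. (1 / s a b) *\<^sub>R (a \<times> b))"
  define t where "t = (\<lambda>a b c. ((a \<times> b) \<bullet> c) / (s a b * s b c))"
  have sc: "s a b = s b a" for a b by (simp add: s_def inner_commute)
  have spos: "s p1 p2 > 0" "s p2 p3 > 0" "s p3 p4 > 0" "s p4 p1 > 0"
    using sides by (simp_all add: s_def)
  \<comment> \<open>The interior angle at \<open>b\<close> and the angle between the two normals are
    supplementary, hence the minus sign.\<close>
  have nn: "n a b \<bullet> n b c = - ang a b c" if "b \<bullet> b = 1" for a b c
    using that by (simp add: n_def dot_cross ang_def s_def inner_commute minus_divide_left)
  have n1: "n a b \<bullet> n a b = 1" if "a \<bullet> a = 1" "b \<bullet> b = 1" "(a \<bullet> b)\<^sup>2 < 1" for a b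
  proof -
    have "s a b * s a b = 1 - (a \<bullet> b)\<^sup>2" "s a b > 0" using that by (simp_all add: s_def)
    then show ?thesis using that
      by (simp add: n_def dot_cross inner_commute field_simps power2_eq_square)
  qed
  have unitn: "n p1 p2 \<bullet> n p1 p2 = 1" "n p2 p3 \<bullet> n p2 p3 = 1" "n p3 p4 \<bullet> n p3 p4 = 1"
    "n p4 p1 \<bullet> n p4 p1 = 1" using unit sides by (simp_all add: n1)
  have prods: "n p4 p1 \<bullet> n p1 p2 = - k" "n p1 p2 \<bullet> n p2 p3 = - k" "n p2 p3 \<bullet> n p3 p4 = - k"
    "n p3 p4 \<bullet> n p4 p1 = - k" using unit ang by (simp_all add: nn)
  \<comment> \<open>The planes of two adjacent sides meet in the line of their common vertex. The
    factor \<open>t\<close> is, up to sign, the sine of the interior angle there.\<close>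
  have cr: "n a b \<times> n b c = t a b c *\<^sub>R b" for a b c
  proof -
    have "(a \<times> b) \<times> (b \<times> c) = ((a \<times> b) \<bullet> c) *\<^sub>R b"
      using exhaust_3 by (force simp add: cross3_simps)
    then show ?thesis by (simp add: n_def t_def cross_mult_left cross_mult_right)
  qed
  have sq: "(t a b c)\<^sup>2 = 1 - k\<^sup>2"
    if "b \<bullet> b = 1" "n a b \<bullet> n a b = 1" "n b c \<bullet> n b c = 1" "n a b \<bullet> n b c = - k" for a b c
  proof -
    have "(n a b \<times> n b c) \<bullet> (n a b \<times> n b c) = 1 - k * k"
      using that by (simp add: dot_cross inner_commute)
    then show ?thesis using that by (simp add: cr power2_eq_square)
  qed
  have sqs: "(t p4 p1 p2)\<^sup>2 = 1 - k\<^sup>2" "(t p1 p2 p3)\<^sup>2 = 1 - k\<^sup>2" "(t p2 p3 p4)\<^sup>2 = 1 - k\<^sup>2"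
    "(t p3 p4 p1)\<^sup>2 = 1 - k\<^sup>2"
    by (rule sq; fact unit unitn prods)+
  have nz: "a \<times> b \<noteq> 0" if "n a b \<bullet> n a b = 1" for a b
    using that by (auto simp: n_def)
  have cyc: "(a \<times> b) \<bullet> c = (b \<times> c) \<bullet> a" for a b c :: "real^3"
    by (simp add: cross3_simps)
  have d: "((p1 \<times> p2) \<bullet> p3) * ((p1 \<times> p2) \<bullet> p4) > 0" "((p2 \<times> p3) \<bullet> p4) * ((p2 \<times> p3) \<bullet> p1) > 0"
    "((p3 \<times> p4) \<bullet> p1) * ((p3 \<times> p4) \<bullet> p2) > 0"
    using cross3_same_side[OF h1 nz] cross3_same_side[OF h2 nz] cross3_same_side[OF h3 nz] unitn by auto
  \<comment> \<open>Convexity at a side says that the factors \<open>t\<close> at its two ends have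
    the same sign. Three sides link all four vertices, so with equal squares all four factors
    agree.\<close>
  have pos: "t p1 p2 p3 * t p4 p1 p2 > 0" "t p2 p3 p4 * t p1 p2 p3 > 0" "t p3 p4 p1 * t p2 p3 p4 > 0"
    unfolding t_def times_divide_times_eq
    using d spos cyc[of p4 p1 p2] cyc[of p1 p2 p3] cyc[of p2 p3 p4]
    by (auto intro!: divide_pos_pos)
  have eq: "x = y" if "x\<^sup>2 = 1 - k\<^sup>2" "y\<^sup>2 = 1 - k\<^sup>2" "x * y > 0" for x y :: real
    using that by (metis mult_minus_right not_square_less_zero power2_eq_iff neg_less_0_iff_less less_irrefl less_asym zero_less_mult_iff neg_0_less_iff_less)
  define \<kappa> where "\<kappa> = t p1 p2 p3"
  have ts: "t p4 p1 p2 = \<kappa>" "t p1 p2 p3 = \<kappa>" "t p2 p3 p4 = \<kappa>" "t p3 p4 p1 = \<kappa>"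
    using eq[OF sqs(2) sqs(1) pos(1)] eq[OF sqs(3) sqs(2) pos(2)] eq[OF sqs(4) sqs(3) pos(3)]
    by (simp_all add: \<kappa>_def)
  have \<kappa>0: "\<kappa> \<noteq> 0" using pos(1) ts by auto
  have crs: "n p4 p1 \<times> n p1 p2 = \<kappa> *\<^sub>R p1" "n p1 p2 \<times> n p2 p3 = \<kappa> *\<^sub>R p2"
    "n p2 p3 \<times> n p3 p4 = \<kappa> *\<^sub>R p3" "n p3 p4 \<times> n p4 p1 = \<kappa> *\<^sub>R p4"
    by (simp_all add: cr ts)
  have ne1: "n p1 p2 - n p3 p4 \<noteq> 0"
  proof
    assume "n p1 p2 - n p3 p4 = 0"
    then have "\<kappa> *\<^sub>R p2 = n p3 p4 \<times> n p2 p3" using crs(2) by simp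
    also have "\<dots> = - (\<kappa> *\<^sub>R p3)" using crs(3) cross_skew[of "n p3 p4" "n p2 p3"] by simp
    finally have "\<kappa> *\<^sub>R p2 = - (\<kappa> *\<^sub>R p3)" .
    then have "p2 = - p3" using \<kappa>0 by (metis scaleR_cancel_left scaleR_minus_right)
    then show False using sides(2) unit by simp
  qed
  have ne2: "n p2 p3 - n p4 p1 \<noteq> 0"
  proof
    assume "n p2 p3 - n p4 p1 = 0"
    then have "\<kappa> *\<^sub>R p1 = n p2 p3 \<times> n p1 p2" using crs(1) by simp
    also have "\<dots> = - (\<kappa> *\<^sub>R p2)" using crs(2) cross_skew[of "n p2 p3" "n p1 p2"] by simp
    finally have "\<kappa> *\<^sub>R p1 = - (\<kappa> *\<^sub>R p2)" .
    then have "p1 = - p2" using \<kappa>0 by (metis scaleR_cancel_left scaleR_minus_right)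
    then show False using sides(1) unit by simp
  qed
  have "(n p2 p3 + n p4 p1) \<times> (n p1 p2 + n p3 p4) = 0"
    by (rule orthogonal_parallel_zero[OF ne1 ne2])
      (use unitn prods in \<open>simp_all add: inner_diff_left inner_diff_right inner_add_left inner_add_right inner_commute\<close>)
  moreover have "(n p2 p3 + n p4 p1) \<times> (n p1 p2 + n p3 p4) = \<kappa> *\<^sub>R (p1 + p3 - p2 - p4)"
    using crs cross_skew[of "n p2 p3" "n p1 p2"] cross_skew[of "n p4 p1" "n p3 p4"]
    by (simp add: cross_add_left cross_add_right algebra_simps)
  ultimately have "p1 + p3 - p2 - p4 = 0" using \<kappa>0 by simp
  then show ?thesis by (simp add: algebra_simps)
qed

unbundle no cross3_syntax

text \<open>The vertices span a three-dimensional subspace, so an isometry carries them to the space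
  where the cross product is available. The convexity witnesses need not lie in that subspace; the
  adjoint of the inverse \<open>g\<close> transports them without changing their products with the
  vertices.\<close>

lemma spherical_rectangle_diagonals:
  assumes "spherical_rectangle p" and nc: "\<And>i j. i \<noteq> j \<Longrightarrow> (p i \<bullet> p j)\<^sup>2 \<noteq> 1"
  shows "p 1 + p 3 = p 2 + p 4"
proof -
  have unit: "norm (p i) = 1" for i
    using assms by (simp add: spherical_rectangle_def spherical_quadrilateral_def)
  have dim: "dim (span (range p)) = dim (UNIV :: (real^3) set)"
    using assms by (simp add: spherical_rectangle_def spherical_quadrilateral_def)
  obtain h where h: "\<And>i. h i \<bullet> p i = 0 \<and> h i \<bullet> p (i + 1) = 0 \<and> h i \<bullet> p (i + 2) > 0 \<and> h i \<bullet> p (i + 3) > 0"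
    using assms unfolding spherical_rectangle_def spherical_quadrilateral_def by metis
  obtain \<theta> where \<theta>: "\<And>i. spherical_angle (p (i - 1)) (p i) (p (i + 1)) = \<theta>"
    using assms unfolding spherical_rectangle_def equiangular_def by metis
  obtain f :: "real^4 \<Rightarrow> real^3" and g where f: "linear f" and g: "linear g"
    and nf: "\<And>x. x \<in> span (range p) \<Longrightarrow> norm (f x) = norm x"
    and gf: "\<And>x. x \<in> span (range p) \<Longrightarrow> g (f x) = x"
    using isometries_subspaces[OF subspace_span subspace_UNIV dim] by metis
  have S: "p i \<in> span (range p)" for i by (simp add: span_base)
  have ipf: "f x \<bullet> f y = x \<bullet> y" if "x \<in> span (range p)" "y \<in> span (range p)" for x y
    using nf[OF span_add[OF that]] nf[OF that(1)] nf[OF that(2)]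
    by (simp add: linear_add[OF f] dot_norm)
  have ip: "f (p i) \<bullet> f (p j) = p i \<bullet> p j" for i j by (simp add: ipf S)
  have ha: "adjoint g (h i) \<bullet> f (p j) = h i \<bullet> p j" for i j
    by (simp add: adjoint_clauses(2)[OF g] gf S)
  have pp: "p i \<bullet> p i = 1" for i using unit[of i] by (simp add: norm_eq_1)
  have lt: "(p i \<bullet> p j)\<^sup>2 < 1" if "i \<noteq> j" for i j
    using Cauchy_Schwarz_ineq[of "p i" "p j"] nc[OF that] by (simp add: pp)
  have tt: "tangent_part a x \<bullet> tangent_part a y = x \<bullet> y - (a \<bullet> x) * (a \<bullet> y)" if "a \<bullet> a = 1" for a x y
    using that by (simp add: tangent_part_def inner_diff_left inner_diff_right inner_commute)
  have tn: "norm (tangent_part (p i) (p j)) = sqrt (1 - (p i \<bullet> p j)\<^sup>2)" for i j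
    by (simp add: norm_eq_sqrt_inner tt pp power2_eq_square)
  \<comment> \<open>This keeps the arguments of \<open>arccos\<close> in its domain, so that equal
    angles have equal cosines. For a zero vector the quotient is 0 by convention.\<close>
  have cs: "\<bar>x \<bullet> y / (norm x * norm y)\<bar> \<le> 1" for x y :: "real^4"
    by (cases "x = 0 \<or> y = 0")
      (use Cauchy_Schwarz_ineq2[of x y] in \<open>auto simp: abs_mult divide_le_eq_1_pos\<close>)
  define k where "k = cos \<theta>"
  have ang: "(p (i - 1) \<bullet> p (i + 1) - (p i \<bullet> p (i - 1)) * (p i \<bullet> p (i + 1))) /
      (sqrt (1 - (p i \<bullet> p (i - 1))\<^sup>2) * sqrt (1 - (p i \<bullet> p (i + 1))\<^sup>2)) = k" (is "?q = k") for i
  proof -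
    have "\<bar>tangent_part (p i) (p (i - 1)) \<bullet> tangent_part (p i) (p (i + 1)) /
        (norm (tangent_part (p i) (p (i - 1))) * norm (tangent_part (p i) (p (i + 1))))\<bar> \<le> 1"
      by (rule cs)
    then have "\<bar>?q\<bar> \<le> 1" by (simp add: tt pp tn)
    moreover have "arccos ?q = \<theta>" using \<theta>[of i] by (simp add: spherical_angle_def tt pp tn)
    ultimately show ?thesis using cos_arccos_abs k_def by metis
  qed
  have zero_eq: "(0::4) = 4" "(5::4) = 1" "(6::4) = 2" by simp_all
  have "f (p 1) + f (p 3) = f (p 2) + f (p 4)"
  proof (rule equiangular_diagonals_R3[where k = k and ?h1.0 = "adjoint g (h 1)" and ?h2.0 = "adjoint g (h 2)"
        and ?h3.0 = "adjoint g (h 3)"])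
  qed (use lt[of 1 2] lt[of 2 3] lt[of 3 4] lt[of 4 1] h[of 1] h[of 2] h[of 3]
      ang[of 1] ang[of 2] ang[of 3] ang[of 4] in \<open>simp_all add: ip ha pp zero_eq\<close>)
  then have "g (f (p 1 + p 3)) = g (f (p 2 + p 4))" by (simp add: linear_add[OF f])
  then show ?thesis by (simp add: gf S span_add)
qed

section \<open>Motions on the whole time axis\<close>

lemma has_real_derivative_inner:
  fixes f g :: "real \<Rightarrow> 'a::real_inner"
  assumes "(f has_vector_derivative f') (at t)" "(g has_vector_derivative g') (at t)"
  shows "((\<lambda>t. f t \<bullet> g t) has_real_derivative (f t \<bullet> g' + f' \<bullet> g t)) (at t)"
  unfolding has_real_derivative_iff_has_vector_derivative
  by (rule bounded_bilinear.has_vector_derivative[OF bounded_bilinear_inner assms])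

lemma has_real_derivative_const_zero:
  assumes "\<And>s. f s = c" "(f has_real_derivative d) (at t)"
  shows "d = 0"
proof -
  have "f = (\<lambda>_. c)" using assms(1) by blast
  then show ?thesis using DERIV_unique[OF assms(2)] DERIV_const[of c "at t"] by simp
qed

text \<open>
  A drift \<open>W\<close> that never increases and is negative once stays negative and drives \<open>X\<close> to \<open>-\<infinity>\<close>; if it
  is positive once, the same happens backwards in time. All uses of the hypothesis that motions
  exist for all times go through this lemma.
\<close>

lemma decreasing_drift_zero:
  fixes X W \<gamma> :: "real \<Rightarrow> real"
  assumes dX: "\<And>t. (X has_real_derivative \<gamma> t * W t) (at t)"
    and \<gamma>: "\<And>t. \<gamma> t \<ge> \<gamma>0" "\<gamma>0 > 0" and X: "\<And>t. X t \<ge> 0"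
    and W: "\<And>s t. s \<le> t \<Longrightarrow> W t \<le> W s"
  shows "W t = 0"
proof -
  have nonneg: "W t0 \<ge> 0"
    if dX: "\<And>t. (X has_real_derivative \<gamma> t * W t) (at t)"
    and \<gamma>: "\<And>t. \<gamma> t \<ge> \<gamma>0" and X: "\<And>t. X t \<ge> 0"
    and W: "\<And>s t. s \<le> t \<Longrightarrow> W t \<le> W s" for X W \<gamma> t0
  proof (rule ccontr)
    assume "\<not> ?thesis"
    then have neg: "W t0 < 0" by simp
    \<comment> \<open>By this time a drift of at most \<open>\<gamma>0 * W t0 < 0\<close> has
      brought \<open>X\<close> down from \<open>X t0\<close> to -1 or below.\<close>
    define t1 where "t1 = t0 + (X t0 + 1) / (- (\<gamma>0 * W t0))"
    have p: "- (\<gamma>0 * W t0) > 0" using neg \<open>\<gamma>0 > 0\<close> by (simp add: mult_pos_neg)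
    have "(X t0 + 1) / (- (\<gamma>0 * W t0)) > 0" using X[of t0] p by (intro divide_pos_pos) auto
    then have "t0 < t1" unfolding t1_def by linarith
    then obtain z where z: "t0 < z" "X t1 - X t0 = (t1 - t0) * (\<gamma> z * W z)"
      using MVT2[OF \<open>t0 < t1\<close> dX] by blast
    have "W z \<le> W t0" using W z by simp
    then have "\<gamma> z * W z \<le> \<gamma>0 * W t0"
      using \<gamma>[of z] \<open>\<gamma>0 > 0\<close> neg
      by (smt (verit) mult_left_mono mult_right_mono_neg)
    then have "(t1 - t0) * (\<gamma> z * W z) \<le> (t1 - t0) * (\<gamma>0 * W t0)"
      using \<open>t0 < t1\<close> by (simp add: mult_left_mono)
    also have "\<dots> = - (X t0 + 1)" using p nonzero_divide_eq_eq[of "\<gamma>0 * W t0" "X t0 + 1"]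
      by (auto simp: t1_def)
    finally show False using z X[of t1] by simp
  qed
  have "W t \<ge> 0" by (rule nonneg[OF dX \<gamma>(1) X W])
  moreover have "- W (- (- t)) \<ge> 0"
  proof (rule nonneg[where X = "\<lambda>t. X (- t)" and \<gamma> = "\<lambda>t. \<gamma> (- t)" and W = "\<lambda>t. - W (- t)"])
    show "((\<lambda>t. X (- t)) has_real_derivative \<gamma> (- s) * - W (- s)) (at s)" for s
      using DERIV_chain'[OF DERIV_minus[OF DERIV_ident] dX[of "- s"]] by simp
  qed (use \<gamma> X W in auto)
  ultimately show ?thesis by simp
qed

text \<open>The pair \<open>(X, W)\<close> turns about the origin at the rate
  \<open>\<Gamma>\<close>, which stays away from 0, so a nonzero pair would give \<open>X\<close>
  both signs. With \<open>X\<close> one-signed, \<open>W\<close> is monotone and the drift argument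
  applies.\<close>

lemma rotation_one_signed_zero:
  fixes X W \<Gamma> :: "real \<Rightarrow> real"
  assumes dX: "\<And>t. (X has_real_derivative \<Gamma> t * W t) (at t)"
    and dW: "\<And>t. (W has_real_derivative - (\<Gamma> t * X t)) (at t)"
    and \<Gamma>: "(\<forall>t. \<Gamma> t \<ge> \<gamma>) \<or> (\<forall>t. \<Gamma> t \<le> - \<gamma>)" "\<gamma> > 0"
    and X: "(\<forall>t. X t \<ge> 0) \<or> (\<forall>t. X t \<le> 0)"
  shows "X t = 0 \<and> W t = 0"
proof -
  have main: "X t = 0 \<and> W t = 0"
    if dX: "\<And>t. (X has_real_derivative \<Gamma> t * W t) (at t)"
    and dW: "\<And>t. (W has_real_derivative - (\<Gamma> t * X t)) (at t)"
    and \<Gamma>: "\<And>t. \<Gamma> t \<ge> \<gamma>" and X: "\<And>t. X t \<ge> 0" for X W \<Gamma>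
  proof -
    have nn: "0 \<le> \<Gamma> z * X z" for z using X[of z] \<Gamma>[of z] \<open>\<gamma> > 0\<close> by simp
    have "W t \<le> W s" if "s \<le> t" for s t
      by (intro DERIV_nonpos_imp_nonincreasing[OF that] exI conjI, rule dW) (simp add: nn)
    then have W: "W t = 0" for t by (rule decreasing_drift_zero[OF dX \<Gamma> \<open>\<gamma> > 0\<close> X])
    have "- (\<Gamma> t * X t) = 0" by (rule has_real_derivative_const_zero[OF W dW])
    then show ?thesis using W \<Gamma>[of t] \<open>\<gamma> > 0\<close> by simp
  qed
  have main2: "X t = 0 \<and> W t = 0"
    if dX: "\<And>t. (X has_real_derivative \<Gamma> t * W t) (at t)"
    and dW: "\<And>t. (W has_real_derivative - (\<Gamma> t * X t)) (at t)"
    and \<Gamma>: "\<And>t. \<Gamma> t \<ge> \<gamma>" for W \<Gamma>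
    using X
  proof
    assume "\<forall>t. X t \<ge> 0"
    then show ?thesis using main[OF that] by simp
  next
    assume "\<forall>t. X t \<le> 0"
    then show ?thesis using main[of "\<lambda>t. - X t" \<Gamma> "\<lambda>t. - W t"] DERIV_minus[OF dX] DERIV_minus[OF dW] \<Gamma>
      by simp
  qed
  show ?thesis
    using \<Gamma>(1)
  proof
    assume "\<forall>t. \<Gamma> t \<ge> \<gamma>"
    then show ?thesis using main2[OF dX dW] by simp
  next
    assume *: "\<forall>t. \<Gamma> t \<le> - \<gamma>"
    have "\<gamma> \<le> - \<Gamma> t" for t using *[rule_format, of t] by simp
    then show ?thesis using main2[of "\<lambda>t. - \<Gamma> t" "\<lambda>t. - W t"] dX DERIV_minus[OF dW] by simp
  qed
qed

text \<open>Sturm comparison: the Wronskian strictly decreases and is at the same time the drift of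
  the positive quotient \<open>B / C\<close>. The bound \<open>C t \<le> 1\<close> keeps the factor
  \<open>1 / (C t)\<^sup>2\<close> above 1.\<close>

lemma central_motions_distinct_rates:
  fixes B B' C C' l k :: "real \<Rightarrow> real"
  assumes dB: "\<And>t. (B has_real_derivative B' t) (at t)" "\<And>t. (B' has_real_derivative l t * B t) (at t)"
    and dC: "\<And>t. (C has_real_derivative C' t) (at t)" "\<And>t. (C' has_real_derivative k t * C t) (at t)"
    and pos: "\<And>t. B t > 0" "\<And>t. C t > 0" and C: "\<And>t. C t \<le> 1" and lk: "\<And>t. l t < k t"
  shows False
proof -
  define W where "W = (\<lambda>t. C t * B' t - B t * C' t)"
  have dW: "(W has_real_derivative (l t - k t) * (B t * C t)) (at t)" for t
    unfolding W_def
    by (rule derivative_eq_intros dB dC refl)+ (simp add: algebra_simps)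
  have neg: "(l t - k t) * (B t * C t) < 0" for t
    using lk pos by (simp add: mult_neg_pos)
  have W0: "W t = 0" for t
  proof (rule decreasing_drift_zero[where W = W and X = "\<lambda>t. B t / C t" and \<gamma> = "\<lambda>t. 1 / (C t)\<^sup>2"])
    show "((\<lambda>t. B t / C t) has_real_derivative 1 / (C t)\<^sup>2 * W t) (at t)" for t
      using pos(2)[of t] unfolding W_def
      by (auto intro!: derivative_eq_intros dB dC simp: field_simps power2_eq_square)
    show "1 \<le> 1 / (C t)\<^sup>2" for t using pos(2)[of t] C[of t] by (simp add: power_le_one)
    show "0 < (1::real)" by simp
    show "0 \<le> B t / C t" for t using pos[of t] by simp
    show "W t \<le> W s" if "s \<le> t" for s t
      by (intro DERIV_nonpos_imp_nonincreasing[OF that] exI conjI, rule dW) (simp add: neg less_imp_le)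
  qed
  have "(l 0 - k 0) * (B 0 * C 0) = 0"
    by (rule has_real_derivative_const_zero[OF W0 dW])
  with neg[of 0] show False by simp
qed

text \<open>The geometric mean of \<open>A\<close> and \<open>B\<close> would be positive and strictly concave on the whole line.\<close>

lemma central_motions_attractive_sum:
  fixes A A' B B' l k :: "real \<Rightarrow> real"
  assumes dA: "\<And>t. (A has_real_derivative A' t) (at t)" "\<And>t. (A' has_real_derivative k t * A t) (at t)"
    and dB: "\<And>t. (B has_real_derivative B' t) (at t)" "\<And>t. (B' has_real_derivative l t * B t) (at t)"
    and pos: "\<And>t. A t > 0" "\<And>t. B t > 0" and lk: "\<And>t. k t + l t < 0"
  shows False
proof -
  define G where "G = (\<lambda>t. sqrt (A t * B t))"
  define W where "W = (\<lambda>t. G t * (A' t / A t + B' t / B t) / 2)"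
  have Gpos: "G t > 0" for t using pos by (simp add: G_def)
  have nz: "A t \<noteq> 0" "B t \<noteq> 0" for t using pos[of t] by simp_all
  have GG: "G t * G t = A t * B t" for t using pos[of t] by (simp add: G_def)
  have dG: "(G has_real_derivative W t) (at t)" for t
  proof -
    have "(G has_real_derivative (A t * B' t + A' t * B t) / (2 * G t)) (at t)"
      using DERIV_chain2[OF DERIV_real_sqrt[OF mult_pos_pos[OF pos]] DERIV_mult[OF dA(1) dB(1)], of t]
      unfolding G_def by (simp add: field_simps)
    moreover have "W t = G t * (A t * B' t + A' t * B t) / (2 * (G t * G t))"
      using nz by (simp add: W_def GG field_simps)
    then have "(A t * B' t + A' t * B t) / (2 * G t) = W t"
      using Gpos[of t] by simp
    ultimately show ?thesis by simp
  qed
  \<comment> \<open>In the second derivative of \<open>G\<close> the logarithmic derivatives of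
    \<open>A\<close> and \<open>B\<close> combine to minus a square. So only the sum of the rates
    has to be negative, not each of them.\<close>
  define D where "D = (\<lambda>t. G t * ((k t + l t) / 2 - (A' t / A t - B' t / B t)\<^sup>2 / 4))"
  have dW: "(W has_real_derivative D t) (at t)" for t
  proof -
    define p q where "p = A' t / A t" and "q = B' t / B t"
    have "((\<lambda>t. A' t / A t + B' t / B t) has_real_derivative k t - p\<^sup>2 + (l t - q\<^sup>2)) (at t)"
      using nz unfolding p_def q_def
      by (auto intro!: derivative_eq_intros dA dB simp: field_simps power2_eq_square)
    from DERIV_cdivide[OF DERIV_mult[OF dG this], of 2]
    have "(W has_real_derivative (W t * (p + q) + (k t - p\<^sup>2 + (l t - q\<^sup>2)) * G t) / 2) (at t)"
      unfolding W_def p_def q_def .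
    moreover have "(W t * (p + q) + (k t - p\<^sup>2 + (l t - q\<^sup>2)) * G t) / 2 = D t"
      unfolding W_def D_def p_def[symmetric] q_def[symmetric]
      by (simp add: field_simps power2_eq_square)
    ultimately show ?thesis by simp
  qed
  have neg: "D t < 0" for t
  proof -
    have "u / 2 - x\<^sup>2 / 4 < 0" if "u < 0" for u x :: real
      using that zero_le_power2[of x] by linarith
    then have "(k t + l t) / 2 - (A' t / A t - B' t / B t)\<^sup>2 / 4 < 0"
      using lk by blast
    then show ?thesis using Gpos unfolding D_def by (simp add: mult_pos_neg)
  qed
  have W0: "W t = 0" for t
  proof (rule decreasing_drift_zero[where W = W and X = G and \<gamma> = "\<lambda>_. 1"])
    show "(G has_real_derivative 1 * W t) (at t)" "0 \<le> G t" for t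
      using dG Gpos by (simp_all add: less_imp_le)
    show "(1::real) \<le> 1" "0 < (1::real)" by simp_all
    show "W t \<le> W s" if "s \<le> t" for s t
      by (intro DERIV_nonpos_imp_nonincreasing[OF that] exI conjI, rule dW) (simp add: neg less_imp_le)
  qed
  have "D 0 = 0" by (rule has_real_derivative_const_zero[OF W0 dW])
  with neg[of 0] show False by simp
qed

text \<open>After three nonzero orthogonal vectors only a line is left in dimension four. This is
  how the dimension of the ambient space enters the dynamics.\<close>

lemma five_orthogonal:
  fixes a b c d e :: "real^4"
  assumes "a \<bullet> b = 0" "a \<bullet> c = 0" "a \<bullet> d = 0" "a \<bullet> e = 0" "b \<bullet> c = 0" "b \<bullet> d = 0" "b \<bullet> e = 0"
    "c \<bullet> d = 0" "c \<bullet> e = 0" "d \<bullet> e = 0" "a \<noteq> 0" "b \<noteq> 0" "c \<noteq> 0"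
  shows "d = 0 \<or> e = 0"
proof (rule ccontr)
  assume "\<not> ?thesis"
  then have nz: "d \<noteq> 0" "e \<noteq> 0" by auto
  have "pairwise orthogonal {a, b, c, d, e}"
    by (auto simp: pairwise_insert orthogonal_def assms(1-10) assms(1-10)[THEN trans[OF inner_commute]])
  then have "independent {a, b, c, d, e}"
    using nz assms(11-13) by (intro pairwise_orthogonal_independent) simp_all
  then have "card {a, b, c, d, e} \<le> 4"
    using independent_bound[of "{a, b, c, d, e}"] by simp
  moreover have "distinct [a, b, c, d, e]" using assms nz by force
  then have "card (set [a, b, c, d, e]) = 5" by (simp only: distinct_card) simp
  ultimately show False by simp
qed

text \<open>The Gram determinant. For a position and its velocity it is the squared size of the
  angular momentum; it vanishes when the motion is radial.\<close>

definition areal_square :: "'a::real_inner \<Rightarrow> 'a \<Rightarrow> real" where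
  "areal_square x y = (x \<bullet> x) * (y \<bullet> y) - (x \<bullet> y)\<^sup>2"

lemma areal_square_zero:
  assumes "x - (y \<bullet> x / (y \<bullet> y)) *\<^sub>R y = 0" "y \<noteq> 0"
  shows "areal_square y x = 0"
proof -
  have "x = (y \<bullet> x / (y \<bullet> y)) *\<^sub>R y" using assms(1) by simp
  then obtain r where r: "x = r *\<^sub>R y" by blast
  show ?thesis unfolding areal_square_def r by (simp add: power2_eq_square)
qed

lemma areal_square_const:
  assumes "\<And>t. (X has_vector_derivative X' t) (at t)"
    and "\<And>t. (X' has_vector_derivative l t *\<^sub>R X t) (at t)"
  shows "areal_square (X s) (X' s) = areal_square (X t) (X' t)"
proof (rule DERIV_isconst_all[where f = "\<lambda>t. areal_square (X t) (X' t)"], rule allI)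
  fix t
  note d = has_real_derivative_inner[OF assms(1) assms(1), of t] has_real_derivative_inner[OF assms(2) assms(2), of t]
    has_real_derivative_inner[OF assms(1) assms(2), of t]
  show "((\<lambda>t. areal_square (X t) (X' t)) has_real_derivative 0) (at t)"
    unfolding areal_square_def
    using DERIV_diff[OF DERIV_mult[OF d(1,2)] DERIV_power[OF d(3), of 2]]
    by (simp add: inner_commute algebra_simps)
qed

text \<open>In general the norm \<open>n\<close> satisfies \<open>n'' = l n + A / n^3\<close>, where
  \<open>A\<close> is the areal square. For a radial motion the centrifugal term drops out and the
  norm solves the same linear equation as the vector, which gives access to the scalar comparison
  lemmas.\<close>

lemma norm_central_motion:
  assumes X: "\<And>t. (X has_vector_derivative X' t) (at t)" "\<And>t. X t \<noteq> 0"
    and X': "\<And>t. (X' has_vector_derivative l t *\<^sub>R X t) (at t)"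
  shows "((\<lambda>t. norm (X t)) has_real_derivative (X t \<bullet> X' t) / norm (X t)) (at t)" (is ?N)
    and "areal_square (X t) (X' t) = 0 \<Longrightarrow>
      ((\<lambda>t. (X t \<bullet> X' t) / norm (X t)) has_real_derivative l t * norm (X t)) (at t)"
proof -
  have pos: "X t \<bullet> X t > 0" using X(2) by simp
  have "((\<lambda>t. sqrt (X t \<bullet> X t)) has_real_derivative
      inverse (sqrt (X t \<bullet> X t)) / 2 * (X t \<bullet> X' t + X' t \<bullet> X t)) (at t)"
    by (rule DERIV_chain2[OF DERIV_real_sqrt[OF pos] has_real_derivative_inner[OF X(1) X(1)]])
  also have "inverse (sqrt (X t \<bullet> X t)) / 2 * (X t \<bullet> X' t + X' t \<bullet> X t) = (X t \<bullet> X' t) / norm (X t)"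
    unfolding norm_eq_sqrt_inner inner_commute[of "X' t" "X t"] by (simp add: inverse_eq_divide)
  finally show N: ?N unfolding norm_eq_sqrt_inner .
  assume h: "areal_square (X t) (X' t) = 0"
  define n where "n = norm (X t)"
  have n: "n > 0" "X t \<bullet> X t = n * n"
    unfolding n_def power2_norm_eq_inner[of "X t", symmetric] power2_eq_square using X(2) by simp_all
  have e: "((L * (n * n) + y) * n - x * (x / n)) / (n * n) = L * n" if "x\<^sup>2 = n * n * y" for L x y
  proof -
    have "x * (x / n) = n * y" using that n(1) by (simp add: field_simps power2_eq_square)
    then show ?thesis using n(1) by (simp add: field_simps)
  qed
  have "((\<lambda>t. (X t \<bullet> X' t) / norm (X t)) has_real_derivative
      ((X t \<bullet> (l t *\<^sub>R X t) + X' t \<bullet> X' t) * n - (X t \<bullet> X' t) * ((X t \<bullet> X' t) / n)) / (n * n)) (at t)"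
    using DERIV_divide[OF has_real_derivative_inner[OF X(1) X', of t] N] X(2)[of t]
    unfolding n_def by simp
  also have "((X t \<bullet> (l t *\<^sub>R X t) + X' t \<bullet> X' t) * n - (X t \<bullet> X' t) * ((X t \<bullet> X' t) / n)) / (n * n) = l t * n"
    unfolding inner_scaleR_right n(2) by (rule e) (use h in \<open>simp add: areal_square_def n(2)\<close>)
  finally show "((\<lambda>t. (X t \<bullet> X' t) / norm (X t)) has_real_derivative l t * norm (X t)) (at t)"
    unfolding n_def .
qed

section \<open>Polar angles of plane curves\<close>

text \<open>Formally both sides are the product of the two squared radii with the derivative of
  \<open>\<alpha>\<close>, but that derivative need not exist. Turning the second curve back by
  \<open>a2 - a1\<close> aligns it with the first; the cross product of the aligned curves vanishes
  identically and can be differentiated instead.\<close>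

lemma polar_common_rate:
  fixes x1 y1 x2 y2 r1 r2 \<alpha> :: "real \<Rightarrow> real"
  assumes p: "\<And>t. x1 t = r1 t * cos (\<alpha> t + a1)" "\<And>t. y1 t = r1 t * sin (\<alpha> t + a1)"
    "\<And>t. x2 t = r2 t * cos (\<alpha> t + a2)" "\<And>t. y2 t = r2 t * sin (\<alpha> t + a2)"
    and d: "(x1 has_real_derivative x1') (at t)" "(y1 has_real_derivative y1') (at t)"
    "(x2 has_real_derivative x2') (at t)" "(y2 has_real_derivative y2') (at t)"
  shows "(r2 t)\<^sup>2 * (x1 t * y1' - y1 t * x1') = (r1 t)\<^sup>2 * (x2 t * y2' - y2 t * x2')"
proof -
  define c s where "c = cos (a2 - a1)" and "s = sin (a2 - a1)"
  define C S where "C = cos (\<alpha> t + a1)" and "S = sin (\<alpha> t + a1)"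
  have cs: "c * c + s * s = 1" unfolding c_def s_def by (metis sin_cos_squared_add3)
  have rot: "x2 u * c + y2 u * s = r2 u * cos (\<alpha> u + a1)" "y2 u * c - x2 u * s = r2 u * sin (\<alpha> u + a1)" for u
  proof -
    have "\<alpha> u + a1 = (\<alpha> u + a2) - (a2 - a1)" by simp
    then show "x2 u * c + y2 u * s = r2 u * cos (\<alpha> u + a1)" "y2 u * c - x2 u * s = r2 u * sin (\<alpha> u + a1)"
      by (simp_all only: p cos_diff sin_diff c_def s_def) (simp_all add: algebra_simps)
  qed
  have zero: "x1 u * (y2 u * c - x2 u * s) - y1 u * (x2 u * c + y2 u * s) = 0" for u
    by (simp add: rot) (simp add: p)
  have "((\<lambda>u. x1 u * (y2 u * c - x2 u * s) - y1 u * (x2 u * c + y2 u * s)) has_real_derivative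
      x1' * (y2 t * c - x2 t * s) + (y2' * c - x2' * s) * x1 t -
      (y1' * (x2 t * c + y2 t * s) + (x2' * c + y2' * s) * y1 t)) (at t)"
    by (intro DERIV_diff DERIV_add DERIV_mult DERIV_cmult_right d)
  from has_real_derivative_const_zero[OF zero this, unfolded rot p(1,2), folded C_def S_def]
  have z: "r2 t * (x1' * S - y1' * C) + r1 t * ((y2' * c - x2' * s) * C - (x2' * c + y2' * s) * S) = 0"
    by (simp add: algebra_simps)
  have w: "r2 t * ((y2' * c - x2' * s) * C - (x2' * c + y2' * s) * S) = x2 t * y2' - y2 t * x2'"
  proof -
    have "r2 t * ((y2' * c - x2' * s) * C - (x2' * c + y2' * s) * S) =
        (y2' * c - x2' * s) * (x2 t * c + y2 t * s) - (x2' * c + y2' * s) * (y2 t * c - x2 t * s)"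
      unfolding rot C_def S_def by (simp add: algebra_simps)
    also have "\<dots> = (c * c + s * s) * (x2 t * y2' - y2 t * x2')" by (simp add: algebra_simps)
    finally show ?thesis by (simp add: cs)
  qed
  have "0 = (r1 t * r2 t) * (r2 t * (x1' * S - y1' * C) + r1 t * ((y2' * c - x2' * s) * C - (x2' * c + y2' * s) * S))"
    using z by simp
  also have "\<dots> = (r2 t)\<^sup>2 * (x1' * (r1 t * S) - y1' * (r1 t * C)) +
      (r1 t)\<^sup>2 * (r2 t * ((y2' * c - x2' * s) * C - (x2' * c + y2' * s) * S))"
    by (simp add: algebra_simps power2_eq_square)
  also have "\<dots> = (r1 t)\<^sup>2 * (x2 t * y2' - y2 t * x2') - (r2 t)\<^sup>2 * (x1 t * y1' - y1 t * x1')"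
    unfolding w by (simp add: p C_def S_def algebra_simps)
  finally show ?thesis by simp
qed

text \<open>At every time some body has a nonzero radius, and its unchanging direction makes the
  derivatives of \<open>cos \<alpha>\<close> and \<open>sin \<alpha>\<close> vanish there, whichever
  body it is. Hence \<open>\<alpha>\<close> is constant modulo \<open>2 * pi\<close>, and continuity
  does the rest.\<close>

lemma polar_angle_constant:
  fixes x y x' y' r :: "'i \<Rightarrow> real \<Rightarrow> real" and \<alpha> :: "real \<Rightarrow> real"
  assumes p: "\<And>i t. x i t = r i t * cos (\<alpha> t + a i)" "\<And>i t. y i t = r i t * sin (\<alpha> t + a i)"
    and d: "\<And>i t. (x i has_real_derivative x' i t) (at t)" "\<And>i t. (y i has_real_derivative y' i t) (at t)"
    and r: "\<And>i t. r i t \<ge> 0" "\<And>t. \<exists>i. r i t \<noteq> 0"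
    and zero: "\<And>i t. x i t * y' i t = y i t * x' i t"
    and \<alpha>: "continuous_on UNIV \<alpha>"
  shows "\<alpha> constant_on UNIV"
proof -
  have dcs: "((\<lambda>t. cos (\<alpha> t)) has_real_derivative 0) (at t) \<and> ((\<lambda>t. sin (\<alpha> t)) has_real_derivative 0) (at t)" for t
  proof -
    obtain i where i: "r i t \<noteq> 0" using r(2) by blast
    \<comment> \<open>The radius is not assumed differentiable, but being nonnegative it equals this
      square root, which is differentiable where it does not vanish.\<close>
    define \<rho> where "\<rho> = (\<lambda>s. sqrt (x i s * x i s + y i s * y i s))"
    have \<rho>r: "\<rho> s = r i s" for s
    proof -
      have "x i s * x i s + y i s * y i s = (r i s)\<^sup>2 * ((cos (\<alpha> s + a i))\<^sup>2 + (sin (\<alpha> s + a i))\<^sup>2)"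
        unfolding p power2_eq_square by (simp only: algebra_simps)
      then show ?thesis using r(1)[of i s] by (simp add: \<rho>_def)
    qed
    have pos: "x i t * x i t + y i t * y i t > 0"
      using i \<rho>r[of t] r(1)[of i t] unfolding \<rho>_def by (metis less_eq_real_def real_sqrt_gt_0_iff)
    have rt: "\<rho> t \<noteq> 0" using i \<rho>r by simp
    have rr: "\<rho> t * \<rho> t = x i t * x i t + y i t * y i t" using pos by (simp add: \<rho>_def)
    define \<rho>' where "\<rho>' = (x i t * x' i t + y i t * y' i t) / \<rho> t"
    have "(\<rho> has_real_derivative inverse (sqrt (x i t * x i t + y i t * y i t)) / 2 *
        (x' i t * x i t + x' i t * x i t + (y' i t * y i t + y' i t * y i t))) (at t)"
      unfolding \<rho>_def
      by (rule DERIV_chain2[OF DERIV_real_sqrt[OF pos] DERIV_add[OF DERIV_mult[OF d(1) d(1)] DERIV_mult[OF d(2) d(2)]]])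
    then have d\<rho>: "(\<rho> has_real_derivative \<rho>') (at t)"
      unfolding \<rho>'_def \<rho>_def by (simp add: inverse_eq_divide add_divide_distrib algebra_simps)
    have dx: "x' i t * \<rho> t - x i t * \<rho>' = 0" "y' i t * \<rho> t - y i t * \<rho>' = 0"
    proof -
      have "(x' i t * \<rho> t - x i t * \<rho>') * \<rho> t = x' i t * (\<rho> t * \<rho> t) - x i t * (x i t * x' i t + y i t * y' i t)"
        using rt by (simp add: \<rho>'_def field_simps)
      also have "\<dots> = - y i t * (x i t * y' i t - y i t * x' i t)" unfolding rr by (simp add: algebra_simps)
      finally show "x' i t * \<rho> t - x i t * \<rho>' = 0" using zero[of i t] rt by simp
      have "(y' i t * \<rho> t - y i t * \<rho>') * \<rho> t = y' i t * (\<rho> t * \<rho> t) - y i t * (x i t * x' i t + y i t * y' i t)"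
        using rt by (simp add: \<rho>'_def field_simps)
      also have "\<dots> = x i t * (x i t * y' i t - y i t * x' i t)" unfolding rr by (simp add: algebra_simps)
      finally show "y' i t * \<rho> t - y i t * \<rho>' = 0" using zero[of i t] rt by simp
    qed
    have "((\<lambda>s. x i s / \<rho> s) has_real_derivative 0) (at t)" "((\<lambda>s. y i s / \<rho> s) has_real_derivative 0) (at t)"
      using DERIV_divide[OF d(1)[of i t] d\<rho> rt] DERIV_divide[OF d(2)[of i t] d\<rho> rt] unfolding dx by simp_all
    note dd = this
    have "eventually (\<lambda>s. \<rho> s \<noteq> 0) (nhds t)"
      using DERIV_isCont[OF d\<rho>] rt
      by (auto simp: isCont_def tendsto_at_iff_tendsto_nhds intro: tendsto_imp_eventually_ne)
    then have ev: "\<forall>\<^sub>F s in nhds t. x i s / \<rho> s = cos (\<alpha> s + a i)" "\<forall>\<^sub>F s in nhds t. y i s / \<rho> s = sin (\<alpha> s + a i)"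
      by (eventually_elim, simp add: \<rho>r p)+
    have D: "((\<lambda>s. cos (\<alpha> s + a i)) has_real_derivative 0) (at t)" "((\<lambda>s. sin (\<alpha> s + a i)) has_real_derivative 0) (at t)"
      using dd DERIV_cong_ev[OF refl ev(1) refl] DERIV_cong_ev[OF refl ev(2) refl] by simp_all
    have c: "cos (\<alpha> s) = cos (\<alpha> s + a i) * cos (a i) + sin (\<alpha> s + a i) * sin (a i)"
      and s: "sin (\<alpha> s) = sin (\<alpha> s + a i) * cos (a i) - cos (\<alpha> s + a i) * sin (a i)" for s
      using cos_diff[of "\<alpha> s + a i" "a i"] sin_diff[of "\<alpha> s + a i" "a i"] by simp_all
    show ?thesis
      using DERIV_add[OF DERIV_cmult_right[OF D(1), of "cos (a i)"] DERIV_cmult_right[OF D(2), of "sin (a i)"]]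
        DERIV_diff[OF DERIV_cmult_right[OF D(2), of "cos (a i)"] DERIV_cmult_right[OF D(1), of "sin (a i)"]]
      unfolding c[symmetric] s[symmetric] by simp
  qed
  have const: "cos (\<alpha> u) = cos (\<alpha> t)" "sin (\<alpha> u) = sin (\<alpha> t)" for t u
    using DERIV_isconst_all[of "\<lambda>t. cos (\<alpha> t)" u t] DERIV_isconst_all[of "\<lambda>t. sin (\<alpha> t)" u t] dcs by blast+
  show ?thesis
  proof (rule continuous_discrete_range_constant[OF connected_UNIV \<alpha>])
    fix t
    have "1 \<le> norm (\<alpha> u - \<alpha> t)" if "\<alpha> u \<noteq> \<alpha> t" for u
    proof -
      have "cos (\<alpha> u - \<alpha> t) = 1" by (simp add: cos_diff const[of u t] sin_cos_squared_add3 add.commute)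
      then obtain n :: int where n: "\<alpha> u - \<alpha> t = n * 2 * pi" by (auto simp: cos_one_2pi_int)
      with that have "n \<noteq> 0" by auto
      then have "1 \<le> \<bar>real_of_int n\<bar>" by linarith
      moreover have "1 \<le> 2 * pi" using pi_ge_two by linarith
      ultimately have "1 * 1 \<le> \<bar>real_of_int n\<bar> * (2 * pi)" by (intro mult_mono) auto
      then show ?thesis by (simp add: n abs_mult)
    qed
    then show "\<exists>e>0. \<forall>u. u \<in> UNIV \<and> \<alpha> u \<noteq> \<alpha> t \<longrightarrow> e \<le> norm (\<alpha> u - \<alpha> t)"
      by (intro exI[of _ 1]) auto
  qed
qed

text \<open>The angle is the imaginary part of a continuous logarithm along the curve. If it were
  constant, the curve would stay on a ray and have no areal rate. The lemma serves to produce the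
  forbidden elliptic rotation in the plane \<open>yz\<close>.\<close>

lemma polar_angle_nonconstant:
  fixes x y x' y' :: "real \<Rightarrow> real"
  assumes d: "\<And>t. (x has_real_derivative x' t) (at t)" "\<And>t. (y has_real_derivative y' t) (at t)"
    and nz: "\<And>t. (x t)\<^sup>2 + (y t)\<^sup>2 \<noteq> 0" and rot: "x u * y' u - y u * x' u \<noteq> 0"
  obtains \<beta> where "continuous_on UNIV \<beta>" "\<not> \<beta> constant_on UNIV"
    "\<And>t. x t = sqrt ((x t)\<^sup>2 + (y t)\<^sup>2) * cos (\<beta> t)" "\<And>t. y t = sqrt ((x t)\<^sup>2 + (y t)\<^sup>2) * sin (\<beta> t)"
proof -
  have cont: "continuous_on UNIV x" "continuous_on UNIV y"
    using d by (auto intro!: continuous_at_imp_continuous_on DERIV_isCont)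
  obtain g where g: "continuous_on UNIV g" "\<And>t. Complex (x t) (y t) = exp (g t)"
  proof (rule continuous_logarithm_on_contractible[of UNIV "\<lambda>t. Complex (x t) (y t)"])
    show "continuous_on UNIV (\<lambda>t. Complex (x t) (y t))"
      unfolding Complex_eq by (intro continuous_intros cont)
    show "contractible (UNIV :: real set)" by (simp add: convex_imp_contractible)
    show "Complex (x t) (y t) \<noteq> 0" for t using nz[of t] by (auto simp: complex_eq_iff)
  qed auto
  define \<beta> where "\<beta> = (\<lambda>t. Im (g t))"
  have re: "sqrt ((x t)\<^sup>2 + (y t)\<^sup>2) = exp (Re (g t))" for t
    by (metis complex_norm norm_exp_eq_Re g(2))
  have px: "x t = sqrt ((x t)\<^sup>2 + (y t)\<^sup>2) * cos (\<beta> t)" and py: "y t = sqrt ((x t)\<^sup>2 + (y t)\<^sup>2) * sin (\<beta> t)" for t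
    unfolding re \<beta>_def using arg_cong[OF g(2)[of t], of Re] arg_cong[OF g(2)[of t], of Im]
    by (simp_all add: Re_exp Im_exp)
  have "\<not> \<beta> constant_on UNIV"
  proof
    assume "\<beta> constant_on UNIV"
    then obtain b where b: "\<And>t. \<beta> t = b" by (auto simp: constant_on_def)
    have "x t * sin b - y t * cos b = 0" for t using px[of t] py[of t] b[of t] by (metis diff_self mult.assoc mult.commute)
    from has_real_derivative_const_zero[OF this DERIV_diff[OF DERIV_cmult_right[OF d(1)] DERIV_cmult_right[OF d(2)]]]
    have z: "x' u * sin b - y' u * cos b = 0" by blast
    define \<rho> where "\<rho> = sqrt ((x u)\<^sup>2 + (y u)\<^sup>2)"
    have "x u = \<rho> * cos b" "y u = \<rho> * sin b" using px[of u] py[of u] by (simp_all add: \<rho>_def b)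
    then have "x u * y' u - y u * x' u = - \<rho> * (x' u * sin b - y' u * cos b)" by (simp add: algebra_simps)
    then show False using rot z by simp
  qed
  moreover have "continuous_on UNIV \<beta>" unfolding \<beta>_def by (intro continuous_intros g)
  ultimately show ?thesis using that px py by blast
qed

section \<open>Three orthogonal central motions\<close>

lemma orthogonal_central_pair:
  fixes X Y X' Y' :: "real \<Rightarrow> 'a::real_inner"
  assumes d: "\<And>t. (X has_vector_derivative X' t) (at t)" "\<And>t. (X' has_vector_derivative l t *\<^sub>R X t) (at t)"
    "\<And>t. (Y has_vector_derivative Y' t) (at t)" "\<And>t. (Y' has_vector_derivative k t *\<^sub>R Y t) (at t)"
    and o: "\<And>t. X t \<bullet> Y t = 0" "\<And>t. X' t \<bullet> Y' t = 0"
  shows "X' t \<bullet> Y t = - (X t \<bullet> Y' t)" and "(l t - k t) * (X t \<bullet> Y' t) = 0"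
    and "X s \<bullet> Y' s = X t \<bullet> Y' t"
proof -
  have c: "X t \<bullet> Y' t + X' t \<bullet> Y t = 0" for t
    by (rule has_real_derivative_const_zero[OF o(1) has_real_derivative_inner[OF d(1,3)]])
  then show e: "X' t \<bullet> Y t = - (X t \<bullet> Y' t)" by (simp add: eq_neg_iff_add_eq_0 add.commute)
  have "X' t \<bullet> (k t *\<^sub>R Y t) + (l t *\<^sub>R X t) \<bullet> Y' t = 0"
    by (rule has_real_derivative_const_zero[OF o(2) has_real_derivative_inner[OF d(2,4)]])
  then show "(l t - k t) * (X t \<bullet> Y' t) = 0" by (simp add: e algebra_simps)
  have "((\<lambda>t. X t \<bullet> Y' t) has_real_derivative 0) (at t)" for t
    using has_real_derivative_inner[OF d(1,4), of t] by (simp add: o)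
  then show "X s \<bullet> Y' s = X t \<bullet> Y' t"
    using DERIV_isconst_all[of "\<lambda>t. X t \<bullet> Y' t" s t] by blast
qed

section \<open>Projections to a coordinate plane\<close>

definition plane_cross :: "4 \<Rightarrow> 4 \<Rightarrow> real^4 \<Rightarrow> real^4 \<Rightarrow> real" where
  "plane_cross j k x y = x $ j * y $ k - x $ k * y $ j"

definition plane_inner :: "4 \<Rightarrow> 4 \<Rightarrow> real^4 \<Rightarrow> real^4 \<Rightarrow> real" where
  "plane_inner j k x y = x $ j * y $ j + x $ k * y $ k"

lemma has_real_derivative_nth:
  fixes X :: "real \<Rightarrow> real^'n"
  assumes "(X has_vector_derivative X') (at t)"
  shows "((\<lambda>t. X t $ i) has_real_derivative X' $ i) (at t)"
  unfolding has_real_derivative_iff_has_vector_derivative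
  by (rule bounded_linear.has_vector_derivative[OF bounded_linear_vec_nth assms])

lemma has_real_derivative_plane_cross:
  assumes "(X has_vector_derivative X') (at t)" "(Y has_vector_derivative Y') (at t)"
  shows "((\<lambda>t. plane_cross j k (X t) (Y t)) has_real_derivative
    plane_cross j k (X t) Y' + plane_cross j k X' (Y t)) (at t)"
proof -
  note d = has_real_derivative_nth[OF assms(1)] has_real_derivative_nth[OF assms(2)]
  show ?thesis
    using DERIV_diff[OF DERIV_mult[OF d(1)[of j] d(2)[of k]] DERIV_mult[OF d(1)[of k] d(2)[of j]]]
    unfolding plane_cross_def by (simp add: algebra_simps)
qed

lemma has_real_derivative_plane_inner:
  assumes "(X has_vector_derivative X') (at t)" "(Y has_vector_derivative Y') (at t)"
  shows "((\<lambda>t. plane_inner j k (X t) (Y t)) has_real_derivative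
    plane_inner j k (X t) Y' + plane_inner j k X' (Y t)) (at t)"
proof -
  note d = has_real_derivative_nth[OF assms(1)] has_real_derivative_nth[OF assms(2)]
  show ?thesis
    using DERIV_add[OF DERIV_mult[OF d(1)[of j] d(2)[of j]] DERIV_mult[OF d(1)[of k] d(2)[of k]]]
    unfolding plane_inner_def by (simp add: algebra_simps)
qed

lemma plane_cross_simps:
  "plane_cross j k (x + y) z = plane_cross j k x z + plane_cross j k y z"
  "plane_cross j k (x - y) z = plane_cross j k x z - plane_cross j k y z"
  "plane_cross j k z (x + y) = plane_cross j k z x + plane_cross j k z y"
  "plane_cross j k z (x - y) = plane_cross j k z x - plane_cross j k z y"
  "plane_cross j k (c *\<^sub>R x) y = c * plane_cross j k x y"
  "plane_cross j k x (c *\<^sub>R y) = c * plane_cross j k x y"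
  "plane_cross j k x x = 0"
  by (simp_all add: plane_cross_def algebra_simps)

lemma plane_cross_skew: "plane_cross j k y x = - plane_cross j k x y"
  by (simp add: plane_cross_def)

lemma plane_inner_simps:
  "plane_inner j k (x + y) z = plane_inner j k x z + plane_inner j k y z"
  "plane_inner j k (x - y) z = plane_inner j k x z - plane_inner j k y z"
  "plane_inner j k z (x + y) = plane_inner j k z x + plane_inner j k z y"
  "plane_inner j k z (x - y) = plane_inner j k z x - plane_inner j k z y"
  "plane_inner j k (c *\<^sub>R x) y = c * plane_inner j k x y"
  "plane_inner j k x (c *\<^sub>R y) = c * plane_inner j k x y"
  by (simp_all add: plane_inner_def algebra_simps)

lemma plane_inner_commute: "plane_inner j k y x = plane_inner j k x y"
  by (simp add: plane_inner_def mult.commute)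

lemma plane_inner_self_eq_0: "plane_inner j k x x = 0 \<longleftrightarrow> x $ j = 0 \<and> x $ k = 0"
  by (simp add: plane_inner_def add_nonneg_eq_0_iff)

lemma plane_inner_self_ge_0: "plane_inner j k x x \<ge> 0"
  by (simp add: plane_inner_def)

text \<open>The Binet-Cauchy identity in the plane with the middle vector repeated. It turns
  orthogonality of two projections into relations between cross and inner products with a third
  vector.\<close>

lemma plane_cross_mult_cross:
  "plane_cross j k x y * plane_cross j k y z =
    plane_inner j k x y * plane_inner j k y z - plane_inner j k x z * plane_inner j k y y"
  by (simp add: plane_inner_def plane_cross_def algebra_simps)

lemma plane_cross_sq:
  "plane_cross j k x y * plane_cross j k x y =
    plane_inner j k x x * plane_inner j k y y - plane_inner j k x y * plane_inner j k x y"
  by (simp add: plane_inner_def plane_cross_def algebra_simps)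

lemma plane_cross_central_const:
  assumes "\<And>t. (X has_vector_derivative X' t) (at t)"
    and "\<And>t. (X' has_vector_derivative l t *\<^sub>R X t) (at t)"
  shows "plane_cross j k (X s) (X' s) = plane_cross j k (X t) (X' t)"
proof (rule DERIV_isconst_all[where f = "\<lambda>t. plane_cross j k (X t) (X' t)"], rule allI)
  fix t
  show "((\<lambda>t. plane_cross j k (X t) (X' t)) has_real_derivative 0) (at t)"
    using has_real_derivative_plane_cross[OF assms(1) assms(2), of j k t]
    by (simp add: plane_cross_simps)
qed

text \<open>What the four-body problem leaves once the rectangle is resolved: the forces enter only
  through the three rates. The third inequality in \<open>rates\<close> expresses attraction, and
  \<open>\<kappa>\<close> is the uniform bound that keeps a rotation rate away from 0.\<close>

locale orthogonal_central_triple =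
  fixes P U V P' U' V' :: "real \<Rightarrow> real^4" and lP lU lV :: "real \<Rightarrow> real" and \<kappa> :: real
  assumes dP: "\<And>t. (P has_vector_derivative P' t) (at t)" "\<And>t. (P' has_vector_derivative lP t *\<^sub>R P t) (at t)"
    and dU: "\<And>t. (U has_vector_derivative U' t) (at t)" "\<And>t. (U' has_vector_derivative lU t *\<^sub>R U t) (at t)"
    and dV: "\<And>t. (V has_vector_derivative V' t) (at t)" "\<And>t. (V' has_vector_derivative lV t *\<^sub>R V t) (at t)"
    and orth: "\<And>t. P t \<bullet> U t = 0" "\<And>t. P t \<bullet> V t = 0" "\<And>t. U t \<bullet> V t = 0"
    and orth': "\<And>t. P' t \<bullet> U' t = 0" "\<And>t. P' t \<bullet> V' t = 0" "\<And>t. U' t \<bullet> V' t = 0"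
    and nonzero: "\<And>t. P t \<noteq> 0" "\<And>t. U t \<noteq> 0" "\<And>t. V t \<noteq> 0"
    and unit: "\<And>t. P t \<bullet> P t + U t \<bullet> U t + V t \<bullet> V t = 1"
    and rates: "\<And>t. lU t < lP t" "\<And>t. lV t < lP t" "\<And>t. lU t + lV t < 0"
    and equal_rates: "\<And>t. lU t = lV t \<Longrightarrow> U t \<bullet> U t = V t \<bullet> V t"
    and \<kappa>: "\<kappa> > 0" "\<And>t. (lP t - lU t) * (U t \<bullet> U t) \<ge> \<kappa>"
begin

lemma P_perp: "P t \<bullet> U' t = 0" "P' t \<bullet> U t = 0" "P t \<bullet> V' t = 0" "P' t \<bullet> V t = 0"
  using orthogonal_central_pair(1,2)[OF dP dU orth(1) orth'(1), of t]
    orthogonal_central_pair(1,2)[OF dP dV orth(2) orth'(2), of t] rates(1,2)[of t] by auto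

lemma UV_skew: "U' t \<bullet> V t = - (U t \<bullet> V' t)"
  by (rule orthogonal_central_pair(1)[OF dU dV orth(3) orth'(3)])

lemma UV_rate: "(lU t - lV t) * (U t \<bullet> V' t) = 0"
  by (rule orthogonal_central_pair(2)[OF dU dV orth(3) orth'(3)])

lemma UV_const: "U s \<bullet> V' s = U t \<bullet> V' t"
  by (rule orthogonal_central_pair(3)[OF dU dV orth(3) orth'(3)])

lemma norm_le_1: "norm (P t) \<le> 1"
proof -
  have "(norm (P t))\<^sup>2 \<le> 1"
    using unit[of t] inner_ge_zero[of "U t"] inner_ge_zero[of "V t"] unfolding power2_norm_eq_inner by linarith
  then show ?thesis by (simp add: power_le_one_iff)
qed

text \<open>
  If \<open>U\<close> and \<open>V\<close> did not rotate into each other, the components of \<open>P'\<close>, \<open>U'\<close>, \<open>V'\<close> orthogonal to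
  \<open>P\<close>, \<open>U\<close>, \<open>V\<close> would be orthogonal vectors in a line, so at least two of the three would have fixed
  directions. None of the three possibilities survives for all times.
\<close>

lemma UV_rotates: "U t \<bullet> V' t \<noteq> 0"
proof
  assume "U t \<bullet> V' t = 0"
  then have g: "U s \<bullet> V' s = 0" "V s \<bullet> U' s = 0" for s
    using UV_const[of s t] UV_skew[of s] by (simp_all add: inner_commute)
  define res where "res = (\<lambda>x' x. x' - (x \<bullet> x' / (x \<bullet> x)) *\<^sub>R x :: real^4)"
  have r0: "x \<bullet> res x' x = 0" if "x \<noteq> 0" for x x'
    using that by (simp add: res_def inner_diff_right)
  have r1: "y \<bullet> res x' x = 0" if "y \<bullet> x' = 0" "y \<bullet> x = 0" for x x' y
    using that by (simp add: res_def inner_diff_right)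
  have r2: "res y' y \<bullet> res x' x = 0" if "y \<bullet> x' = 0" "y \<bullet> x = 0" "y' \<bullet> x' = 0" "y' \<bullet> x = 0" for x x' y y'
    using that by (simp add: res_def inner_diff_right inner_diff_left)
  note o = orth[of 0] orth'[of 0] P_perp[of 0] g[of 0]
    orth[of 0, THEN trans[OF inner_commute]] orth'[of 0, THEN trans[OF inner_commute]]
    P_perp[of 0, THEN trans[OF inner_commute]] g[of 0, THEN trans[OF inner_commute]] nonzero[of 0]
  have two: "res (P' 0) (P 0) = 0 \<or> res (U' 0) (U 0) = 0" "res (P' 0) (P 0) = 0 \<or> res (V' 0) (V 0) = 0"
    "res (U' 0) (U 0) = 0 \<or> res (V' 0) (V 0) = 0"
    by (rule five_orthogonal[of "P 0" "U 0" "V 0"]; simp add: o r0 r1 r2)+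
  have aP: "areal_square (P s) (P' s) = 0" if "res (P' 0) (P 0) = 0" for s
    using areal_square_zero[OF that[unfolded res_def] nonzero(1)] areal_square_const[OF dP, of s 0] by simp
  have aU: "areal_square (U s) (U' s) = 0" if "res (U' 0) (U 0) = 0" for s
    using areal_square_zero[OF that[unfolded res_def] nonzero(2)] areal_square_const[OF dU, of s 0] by simp
  have aV: "areal_square (V s) (V' s) = 0" if "res (V' 0) (V 0) = 0" for s
    using areal_square_zero[OF that[unfolded res_def] nonzero(3)] areal_square_const[OF dV, of s 0] by simp
  note nP = norm_central_motion[OF dP(1) nonzero(1) dP(2)]
  note nU = norm_central_motion[OF dU(1) nonzero(2) dU(2)]
  note nV = norm_central_motion[OF dV(1) nonzero(3) dV(2)]
  \<comment> \<open>If \<open>P\<close> is one of the two radial motions, the rates differ strictly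
    and the Wronskian comparison applies, with \<open>norm (P t) \<le> 1\<close>. If
    \<open>U\<close> and \<open>V\<close> are the two, only the negative sum of their rates is
    available.\<close>
  consider "res (P' 0) (P 0) = 0" "res (U' 0) (U 0) = 0" | "res (P' 0) (P 0) = 0" "res (V' 0) (V 0) = 0"
    | "res (U' 0) (U 0) = 0" "res (V' 0) (V 0) = 0" using two by blast
  then show False
  proof cases
    case 1
    show False
      by (rule central_motions_distinct_rates[OF nU(1) nU(2)[OF aU[OF 1(2)]] nP(1) nP(2)[OF aP[OF 1(1)]]])
        (use nonzero norm_le_1 rates in auto)
  next
    case 2
    show False
      by (rule central_motions_distinct_rates[OF nV(1) nV(2)[OF aV[OF 2(2)]] nP(1) nP(2)[OF aP[OF 2(1)]]])
        (use nonzero norm_le_1 rates in auto)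
  next
    case 3
    show False
      by (rule central_motions_attractive_sum[OF nU(1) nU(2)[OF aU[OF 3(1)]] nV(1) nV(2)[OF aV[OF 3(2)]]])
        (use nonzero rates in auto)
  qed
qed

lemma lU_eq_lV: "lU t = lV t"
  using UV_rate[of t] UV_rotates[of t] by simp

lemma square: "U t \<bullet> U t = V t \<bullet> V t"
  by (rule equal_rates[OF lU_eq_lV])

text \<open>\<open>a\<close> is the common stretching rate of \<open>U\<close> and \<open>V\<close>,
  and \<open>b\<close> is the rate at which they turn in their plane.\<close>

definition a where "a t = U t \<bullet> U' t / (U t \<bullet> U t)"
definition b where "b t = U t \<bullet> V' t / (U t \<bullet> U t)"

lemma b_nonzero: "b t \<noteq> 0"
  using UV_rotates nonzero by (simp add: b_def)

text \<open>Differentiating the equality of the lengths of \<open>U\<close> and \<open>V\<close>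
  twice gives \<open>U'\<close> and \<open>V'\<close> equal lengths. Their parts outside the plane
  of \<open>U\<close> and \<open>V\<close> are then equally long, orthogonal to each other and to
  \<open>P\<close>, \<open>U\<close>, \<open>V\<close>; one of them vanishes by the dimension count,
  hence both.\<close>

lemma UV_velocity: "U' t = a t *\<^sub>R U t - b t *\<^sub>R V t" "V' t = a t *\<^sub>R V t + b t *\<^sub>R U t"
proof -
  have s1: "U t \<bullet> U' t = V t \<bullet> V' t" for t
  proof -
    have "((\<lambda>t. U t \<bullet> U t) has_real_derivative (U t \<bullet> U' t + U' t \<bullet> U t)) (at t)"
      "((\<lambda>t. U t \<bullet> U t) has_real_derivative (V t \<bullet> V' t + V' t \<bullet> V t)) (at t)"
      using has_real_derivative_inner[OF dU(1) dU(1)] has_real_derivative_inner[OF dV(1) dV(1)]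
      unfolding square by auto
    then show ?thesis by (auto dest: DERIV_unique simp: inner_commute)
  qed
  have s2: "U' t \<bullet> U' t = V' t \<bullet> V' t"
  proof -
    have "((\<lambda>t. U t \<bullet> U' t) has_real_derivative (U t \<bullet> (lU t *\<^sub>R U t) + U' t \<bullet> U' t)) (at t)"
      "((\<lambda>t. U t \<bullet> U' t) has_real_derivative (V t \<bullet> (lV t *\<^sub>R V t) + V' t \<bullet> V' t)) (at t)"
      using has_real_derivative_inner[OF dU(1) dU(2)] has_real_derivative_inner[OF dV(1) dV(2)]
      unfolding s1 by auto
    then show ?thesis using DERIV_unique lU_eq_lV[of t] square[of t] by fastforce
  qed
  define N where "N = U t \<bullet> U t"
  have N: "N \<noteq> 0" using nonzero by (simp add: N_def)
  define x where "x = U' t - a t *\<^sub>R U t + b t *\<^sub>R V t"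
  define y where "y = V' t - a t *\<^sub>R V t - b t *\<^sub>R U t"
  have ip: "U t \<bullet> U t = N" "V t \<bullet> V t = N" "U t \<bullet> U' t = a t * N" "V t \<bullet> V' t = a t * N"
    "U t \<bullet> V' t = b t * N" "V t \<bullet> U' t = - (b t * N)" "U t \<bullet> V t = 0" "V t \<bullet> U t = 0"
    using N square[of t] s1[of t] UV_skew[of t] orth(3)[of t]
    by (simp_all add: N_def a_def b_def inner_commute)
  note ip' = ip[THEN trans[OF inner_commute]]
  have "x \<bullet> x = y \<bullet> y"
    unfolding x_def y_def using s2 orth'(3)[of t]
    by (simp add: inner_diff_left inner_diff_right inner_add_left inner_add_right ip ip' algebra_simps)
  moreover have "x = 0 \<or> y = 0"
    using nonzero[of t] orth[of t] orth'[of t] P_perp[of t]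
    by (intro five_orthogonal[of "P t" "U t" "V t"])
      (simp_all add: x_def y_def inner_diff_left inner_diff_right inner_add_left inner_add_right ip ip' algebra_simps)
  ultimately have "x = 0 \<and> y = 0" by auto
  then show "U' t = a t *\<^sub>R U t - b t *\<^sub>R V t" "V' t = a t *\<^sub>R V t + b t *\<^sub>R U t"
    unfolding x_def y_def by (auto simp: algebra_simps add_eq_0_iff2)
qed

end

section \<open>The rotating square and its projections\<close>

context orthogonal_central_triple
begin

text \<open>\<open>D\<close> and \<open>E\<close> are the half-diagonals: the bodies are
  \<open>P\<close> plus or minus \<open>D\<close> and \<open>P\<close> plus or minus
  \<open>E\<close>. For a square they are orthogonal and equally long, and they move by the same
  similarities as \<open>U\<close> and \<open>V\<close>.\<close>

definition D where "D t = U t + V t"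
definition E where "E t = V t - U t"
definition D' where "D' t = a t *\<^sub>R D t - b t *\<^sub>R E t"
definition E' where "E' t = a t *\<^sub>R E t + b t *\<^sub>R D t"

lemma D'_E'_eq: "D' t = U' t + V' t" "E' t = V' t - U' t"
  by (simp_all add: D'_def E'_def D_def E_def UV_velocity algebra_simps)

lemma dD: "(D has_vector_derivative D' t) (at t)" "(D' has_vector_derivative lU t *\<^sub>R D t) (at t)"
  using has_vector_derivative_add[OF dU(1) dV(1), of t] has_vector_derivative_add[OF dU(2) dV(2), of t]
  unfolding D_def[abs_def] D'_E'_eq[abs_def] lU_eq_lV by (simp_all add: scaleR_add_right)

lemma dE: "(E has_vector_derivative E' t) (at t)" "(E' has_vector_derivative lU t *\<^sub>R E t) (at t)"
  using has_vector_derivative_diff[OF dV(1) dU(1), of t] has_vector_derivative_diff[OF dV(2) dU(2), of t]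
  unfolding E_def[abs_def] D'_E'_eq[abs_def] lU_eq_lV by (simp_all add: scaleR_diff_right)

lemma DE_orth: "P t \<bullet> D t = 0" "P t \<bullet> E t = 0" "D t \<bullet> E t = 0"
  using orth[of t] square[of t]
  by (simp_all add: D_def E_def inner_add_left inner_add_right inner_diff_left inner_diff_right inner_commute)

lemma DE_inner: "D t \<bullet> D t = 2 * (U t \<bullet> U t)" "E t \<bullet> E t = D t \<bullet> D t"
  using orth(3)[of t] square[of t]
  by (simp_all add: D_def E_def inner_add_left inner_add_right inner_diff_left inner_diff_right inner_commute)

lemma DE_nonzero: "D t \<noteq> 0" "E t \<noteq> 0"
  using DE_inner[of t] nonzero(2)[of t] by auto

text \<open>\<open>D t \<bullet> D t\<close> has the same logarithmic derivative
  \<open>2 * a t\<close>. So the shape of the projected pair \<open>(D, E)\<close> stays the same up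
  to size.\<close>

lemma scaling_ratio_const:
  assumes "\<And>t. (f has_real_derivative 2 * a t * f t) (at t)"
  shows "f s / (D s \<bullet> D s) = f t / (D t \<bullet> D t)"
proof (rule DERIV_isconst_all[where f = "\<lambda>t. f t / (D t \<bullet> D t)"], rule allI)
  fix t
  have "D t \<bullet> D' t + D' t \<bullet> D t = 2 * a t * (D t \<bullet> D t)"
    using DE_orth(3)[of t] by (simp add: D'_def inner_diff_left inner_diff_right inner_commute)
  then have "((\<lambda>t. D t \<bullet> D t) has_real_derivative 2 * a t * (D t \<bullet> D t)) (at t)"
    using has_real_derivative_inner[OF dD(1) dD(1), of t] by simp
  from DERIV_divide[OF assms this] show "((\<lambda>t. f t / (D t \<bullet> D t)) has_real_derivative 0) (at t)"
    using DE_nonzero[of t] by (simp add: algebra_simps)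
qed

lemma cross_DE_ratio_const:
  "plane_cross j k (D s) (E s) / (D s \<bullet> D s) = plane_cross j k (D t) (E t) / (D t \<bullet> D t)"
proof (rule scaling_ratio_const)
  fix t
  show "((\<lambda>t. plane_cross j k (D t) (E t)) has_real_derivative 2 * a t * plane_cross j k (D t) (E t)) (at t)"
    using has_real_derivative_plane_cross[OF dD(1) dE(1), of j k t]
    by (simp add: D'_def E'_def plane_cross_simps mult.assoc)
qed

definition body :: "4 \<Rightarrow> real \<Rightarrow> real^4" where
  "body i t = (if i = 1 then P t + D t else if i = 2 then P t + E t else if i = 3 then P t - D t else P t - E t)"

definition vel :: "4 \<Rightarrow> real \<Rightarrow> real^4" where
  "vel i t = (if i = 1 then P' t + D' t else if i = 2 then P' t + E' t else if i = 3 then P' t - D' t else P' t - E' t)"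

lemma body_simps: "body 1 t = P t + D t" "body 2 t = P t + E t" "body 3 t = P t - D t" "body 4 t = P t - E t"
  by (simp_all add: body_def)

lemma vel_simps: "vel 1 t = P' t + D' t" "vel 2 t = P' t + E' t" "vel 3 t = P' t - D' t" "vel 4 t = P' t - E' t"
  by (simp_all add: vel_def)

lemma body_deriv: "(body i has_vector_derivative vel i t) (at t)"
  unfolding body_def[abs_def] vel_def
  by (auto intro!: has_vector_derivative_add has_vector_derivative_diff dP dD dE)

lemma sum_cross:
  "(\<Sum>i\<in>UNIV. plane_cross j k (body i t) (vel i t)) =
    4 * plane_cross j k (P t) (P' t) + 2 * (plane_cross j k (D t) (D' t) + plane_cross j k (E t) (E' t))"
  by (simp add: sum_4 body_simps vel_simps plane_cross_simps)

lemma P_coordinates_zero: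
  assumes "\<And>t. P t $ i = 0" shows "P' t $ i = 0"
  by (rule has_real_derivative_const_zero[OF assms has_real_derivative_nth[OF dP(1)]])

text \<open>
  If \<open>P\<close> had a component in the plane \<open>jk\<close> while \<open>D\<close> and \<open>E\<close> project to a square there, the projections
  of \<open>P\<close> to the two diagonals would rotate into each other at a rate bounded away from 0. But by
  the rotation hypothesis the first of them has a constant sign.
\<close>

lemma elliptic_projection:
  assumes ell: "elliptic_rotation body j k" and jk: "j \<noteq> k"
  shows "(\<Sum>i\<in>UNIV. plane_cross j k (body i t) (vel i t)) \<noteq> 0"
    and "plane_inner j k (D t) (D t) = plane_inner j k (E t) (E t)"
    and "plane_inner j k (D t) (E t) = 0"
    and "(\<forall>t. plane_inner j k (D t) (D t) = 0) \<or> (\<forall>t. plane_inner j k (P t) (P t) = 0)"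
proof -
  let ?x = "plane_cross j k" and ?i = "plane_inner j k"
  obtain \<alpha> ang r where \<alpha>: "continuous_on UNIV \<alpha>" "\<not> \<alpha> constant_on UNIV"
    and r: "\<And>i t. r i t \<ge> 0"
    and pj: "\<And>i t. body i t $ j = r i t * cos (\<alpha> t + ang i)"
    and pk: "\<And>i t. body i t $ k = r i t * sin (\<alpha> t + ang i)"
    using ell unfolding elliptic_rotation_def by metis
  define \<Omega> where "\<Omega> i t = ?x (body i t) (vel i t)" for i t
  define S where "S t = (\<Sum>i\<in>UNIV. \<Omega> i t)" for t
  define R where "R t = (\<Sum>i\<in>UNIV. (r i t)\<^sup>2)" for t
  have rate: "(r l t)\<^sup>2 * \<Omega> i t = (r i t)\<^sup>2 * \<Omega> l t" for i l t
    unfolding \<Omega>_def plane_cross_def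
    by (rule polar_common_rate[where ?x1.0 = "\<lambda>t. body i t $ j" and ?y1.0 = "\<lambda>t. body i t $ k"
          and ?x2.0 = "\<lambda>t. body l t $ j" and ?y2.0 = "\<lambda>t. body l t $ k" and \<alpha> = \<alpha> and ?r1.0 = "r i" and ?r2.0 = "r l"])
      (rule pj pk has_real_derivative_nth[OF body_deriv])+
  \<comment> \<open>Summed over \<open>l\<close>, the common rate says that body \<open>i\<close>
    carries the fraction \<open>(r i t)\<^sup>2 / R t\<close> of the total
    \<open>S t\<close>.\<close>
  have RS: "R t * \<Omega> i t = (r i t)\<^sup>2 * S t" for i t
    unfolding R_def S_def sum_distrib_left sum_distrib_right by (simp add: rate)
  have rsq: "(r i t)\<^sup>2 = ?i (body i t) (body i t)" for i t
  proof -
    have "?i (body i t) (body i t) = (r i t)\<^sup>2 * ((cos (\<alpha> t + ang i))\<^sup>2 + (sin (\<alpha> t + ang i))\<^sup>2)"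
      unfolding plane_inner_def pj pk power2_eq_square by (simp only: algebra_simps)
    then show ?thesis by simp
  qed
  \<comment> \<open>Otherwise \<open>P\<close>, \<open>D\<close>, \<open>E\<close> would be
    orthogonal to both coordinate axes of the plane, five orthogonal vectors in all.\<close>
  have some: "\<exists>i. r i t \<noteq> 0" for t
  proof (rule ccontr)
    assume "\<not> ?thesis"
    then have "body i t $ j = 0" "body i t $ k = 0" for i using pj pk by auto
    then have z: "P t $ j + D t $ j = 0" "P t $ j - D t $ j = 0" "P t $ j + E t $ j = 0" "P t $ j - E t $ j = 0"
      "P t $ k + D t $ k = 0" "P t $ k - D t $ k = 0" "P t $ k + E t $ k = 0" "P t $ k - E t $ k = 0"
      using body_simps[of t] by (metis vector_add_component vector_minus_component)+
    then have "P t $ j = 0" "D t $ j = 0" "E t $ j = 0" "P t $ k = 0" "D t $ k = 0" "E t $ k = 0" by linarith+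
    moreover have ajk: "(axis j 1 :: real^4) $ k = 0" using jk by (simp add: axis_def)
    ultimately have "axis j 1 = (0::real^4) \<or> axis k 1 = (0::real^4)"
      using DE_orth DE_nonzero nonzero(1) jk
      by (intro five_orthogonal[of "P t" "D t" "E t"]) (auto simp: inner_axis inner_axis_axis ajk)
    then show False by (simp add: axis_eq_0_iff)
  qed
  have Rpos: "R t > 0" for t
  proof -
    obtain i where "r i t \<noteq> 0" using some by blast
    then show ?thesis unfolding R_def by (intro sum_pos2[of _ i]) auto
  qed
  have Sconst: "S s = S t" for s t
    unfolding S_def \<Omega>_def sum_cross
    using plane_cross_central_const[OF dP, of j k s t] plane_cross_central_const[OF dD, of j k s t]
      plane_cross_central_const[OF dE, of j k s t] by simp
  have S0: "S t \<noteq> 0" for t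
  proof
    assume "S t = 0"
    then have "S u = 0" for u using Sconst[of u t] by simp
    then have "\<Omega> i u = 0" for i u using RS[of u i] Rpos[of u] by simp
    then have "body i u $ j * vel i u $ k = body i u $ k * vel i u $ j" for i u
      by (simp add: \<Omega>_def plane_cross_def)
    with has_real_derivative_nth[OF body_deriv] has_real_derivative_nth[OF body_deriv] have "\<alpha> constant_on UNIV"
      by (rule polar_angle_constant[OF pj pk _ _ r some _ \<alpha>(1)])
    then show False using \<alpha>(2) by simp
  qed
  then show "(\<Sum>i\<in>UNIV. ?x (body i t) (vel i t)) \<noteq> 0" by (simp add: S_def \<Omega>_def)
  \<comment> \<open>The similarity gives both diagonals the same areal rate, so opposite pairs carry
    equal shares and have equal sums of squared radii.\<close>
  have DE: "?i (D t) (D t) = ?i (E t) (E t)" for t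
  proof -
    have "\<Omega> 1 t + \<Omega> 3 t = \<Omega> 2 t + \<Omega> 4 t"
      by (simp add: \<Omega>_def body_simps vel_simps plane_cross_simps D'_def E'_def)
        (simp add: plane_cross_skew[of j k "D t" "E t"] algebra_simps)
    then have "R t * \<Omega> 1 t + R t * \<Omega> 3 t = R t * \<Omega> 2 t + R t * \<Omega> 4 t" by (metis distrib_left)
    then have "((r 1 t)\<^sup>2 + (r 3 t)\<^sup>2) * S t = ((r 2 t)\<^sup>2 + (r 4 t)\<^sup>2) * S t"
      by (simp add: RS distrib_right)
    then have "(r 1 t)\<^sup>2 + (r 3 t)\<^sup>2 = (r 2 t)\<^sup>2 + (r 4 t)\<^sup>2" using S0 by simp
    then show ?thesis by (simp add: rsq body_simps plane_inner_simps)
  qed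
  then show "?i (D t) (D t) = ?i (E t) (E t)" .
  \<comment> \<open>The equality of the projected lengths persists although \<open>D\<close> and
    \<open>E\<close> turn into each other at the nonzero rate \<open>b\<close>. Its derivative is a
    nonzero multiple of the inner product.\<close>
  have DE0: "?i (D t) (E t) = 0" for t
  proof -
    have "?i (D t) (D' t) + ?i (D' t) (D t) - (?i (E t) (E' t) + ?i (E' t) (E t)) = 0"
      by (rule has_real_derivative_const_zero[OF _ DERIV_diff[OF has_real_derivative_plane_inner[OF dD(1) dD(1)]
              has_real_derivative_plane_inner[OF dE(1) dE(1)]]]) (simp add: DE)
    then have "b t * ?i (D t) (E t) = 0"
      using DE[of t] by (simp add: D'_def E'_def plane_inner_simps plane_inner_commute[of j k "E t" "D t"])
    then show ?thesis using b_nonzero by simp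
  qed
  then show "?i (D t) (E t) = 0" .
  define \<sigma> where "\<sigma> = ?i (D 0) (D 0) / (D 0 \<bullet> D 0)"
  have \<sigma>: "?i (D t) (D t) = \<sigma> * (D t \<bullet> D t)" for t
  proof -
    have "?i (D t) (D t) / (D t \<bullet> D t) = \<sigma>" unfolding \<sigma>_def
    proof (rule scaling_ratio_const)
      fix t
      show "((\<lambda>t. ?i (D t) (D t)) has_real_derivative 2 * a t * ?i (D t) (D t)) (at t)"
        using has_real_derivative_plane_inner[OF dD(1) dD(1), of j k t] DE0[of t]
        by (simp add: D'_def plane_inner_simps plane_inner_commute[of j k "E t" "D t"] mult.assoc)
    qed
    then show ?thesis using DE_nonzero[of t] by (simp add: field_simps)
  qed
  have "?i (P t) (P t) = 0" if \<sigma>0: "\<sigma> \<noteq> 0" for t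
  proof -
    have \<sigma>pos: "\<sigma> > 0" using \<sigma>0 plane_inner_self_ge_0[of j k "D 0"] by (simp add: \<sigma>_def less_le)
    have dpos: "?i (D t) (D t) > 0" for t using DE_nonzero[of t] \<sigma>pos by (simp add: \<sigma>)
    \<comment> \<open>The orientation, 1 or -1, of the projected square: the projection of
      \<open>E\<close> is that of \<open>D\<close> after a quarter turn in the direction
      \<open>\<epsilon>\<close>.\<close>
    define \<epsilon> where "\<epsilon> = ?x (D 0) (E 0) / (D 0 \<bullet> D 0) / \<sigma>"
    have \<epsilon>: "?x (D t) (E t) = \<epsilon> * ?i (D t) (D t)" for t
      using cross_DE_ratio_const[of j k t 0] DE_nonzero[of t] \<sigma>0 by (simp add: \<sigma> \<epsilon>_def field_simps)
    have \<epsilon>2: "\<epsilon> * \<epsilon> = 1"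
      using plane_cross_sq[of j k "D 0" "E 0"] dpos[of 0] by (simp add: DE0 DE[symmetric] \<epsilon>)
    have PE: "?i (P t) (E t) = - \<epsilon> * ?x (P t) (D t)" for t
    proof -
      have "(?i (P t) (E t) + \<epsilon> * ?x (P t) (D t)) * ?i (D t) (D t) = 0"
        using plane_cross_mult_cross[of j k "P t" "D t" "E t"] by (simp add: DE0 \<epsilon> algebra_simps)
      then show ?thesis using dpos[of t] by (simp add: eq_neg_iff_add_eq_0)
    qed
    have xPE: "?x (P t) (E t) = \<epsilon> * ?i (P t) (D t)" for t
    proof -
      have "(\<epsilon> * ?x (P t) (E t) - ?i (P t) (D t)) * ?i (D t) (D t) = 0"
        using plane_cross_mult_cross[of j k "P t" "E t" "D t"]
        by (simp add: DE0 \<epsilon> plane_cross_skew[of j k "E t" "D t"] plane_inner_commute[of j k "E t" "D t"] DE[symmetric] algebra_simps)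
      then have e: "?i (P t) (D t) = \<epsilon> * ?x (P t) (E t)" using dpos[of t] by simp
      show ?thesis unfolding e mult.assoc[symmetric] \<epsilon>2 by simp
    qed
    \<comment> \<open>\<open>X\<close> and \<open>Y\<close> are half the differences of the rates
      \<open>\<Omega>\<close> of opposite bodies. The shares make them multiples of inner products
      of \<open>P\<close> with the diagonals, the equations of motion make their derivatives
      multiples of cross products, and the quarter turn \<open>\<epsilon>\<close> exchanges the two
      kinds. So the system for \<open>X\<close> and \<open>Y\<close> closes as a rotation at the
      rate \<open>\<Gamma>\<close>.\<close>
    define X where "X t = ?x (P t) (E' t) - ?x (P' t) (E t)" for t
    define Y where "Y t = ?x (P t) (D' t) - ?x (P' t) (D t)" for t
    have RX: "R t * X t = 2 * ?i (P t) (E t) * S t" for t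
    proof -
      have "2 * (R t * X t) = R t * \<Omega> 2 t - R t * \<Omega> 4 t"
        by (simp add: X_def \<Omega>_def body_simps vel_simps plane_cross_simps algebra_simps plane_cross_skew[of j k "P' t" "E t"])
      also have "\<dots> = 4 * ?i (P t) (E t) * S t"
        by (simp add: RS rsq body_simps plane_inner_simps algebra_simps plane_inner_commute[of j k "E t" "P t"])
      finally show ?thesis by simp
    qed
    have RY: "R t * Y t = 2 * ?i (P t) (D t) * S t" for t
    proof -
      have "2 * (R t * Y t) = R t * \<Omega> 1 t - R t * \<Omega> 3 t"
        by (simp add: Y_def \<Omega>_def body_simps vel_simps plane_cross_simps algebra_simps plane_cross_skew[of j k "P' t" "D t"])
      also have "\<dots> = 4 * ?i (P t) (D t) * S t"
        by (simp add: RS rsq body_simps plane_inner_simps algebra_simps plane_inner_commute[of j k "D t" "P t"])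
      finally show ?thesis by simp
    qed
    define s where "s = S 0"
    have s: "S t = s" "s \<noteq> 0" for t using Sconst[of t 0] S0[of 0] by (simp_all add: s_def)
    define \<Gamma> where "\<Gamma> t = (lP t - lU t) * R t / (2 * s)" for t
    have dX: "(X has_real_derivative \<Gamma> t * (- \<epsilon> * Y t)) (at t)" for t
    proof -
      have "(X has_real_derivative (lU t - lP t) * ?x (P t) (E t)) (at t)"
        using DERIV_diff[OF has_real_derivative_plane_cross[OF dP(1) dE(2), of j k t] has_real_derivative_plane_cross[OF dP(2) dE(1), of j k t]]
        unfolding X_def by (simp add: plane_cross_simps algebra_simps)
      moreover have "\<Gamma> t * (- \<epsilon> * Y t) = (lU t - lP t) * ?x (P t) (E t)"
      proof -
        have "\<Gamma> t * (- \<epsilon> * Y t) = - \<epsilon> * (lP t - lU t) * (R t * Y t) / (2 * s)" by (simp add: \<Gamma>_def)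
        also have "\<dots> = - \<epsilon> * (lP t - lU t) * ?i (P t) (D t)" unfolding RY s(1) using s(2) by simp
        finally show ?thesis by (simp add: xPE algebra_simps)
      qed
      ultimately show ?thesis by simp
    qed
    have dY: "((\<lambda>t. - \<epsilon> * Y t) has_real_derivative - (\<Gamma> t * X t)) (at t)" for t
    proof -
      have "(Y has_real_derivative (lU t - lP t) * ?x (P t) (D t)) (at t)"
        using DERIV_diff[OF has_real_derivative_plane_cross[OF dP(1) dD(2), of j k t] has_real_derivative_plane_cross[OF dP(2) dD(1), of j k t]]
        unfolding Y_def by (simp add: plane_cross_simps algebra_simps)
      from DERIV_cmult[OF this, of "- \<epsilon>"]
      have "((\<lambda>t. - \<epsilon> * Y t) has_real_derivative - \<epsilon> * ((lU t - lP t) * ?x (P t) (D t))) (at t)" .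
      moreover have "- (\<Gamma> t * X t) = - \<epsilon> * ((lU t - lP t) * ?x (P t) (D t))"
      proof -
        have "\<Gamma> t * X t = (lP t - lU t) * (R t * X t) / (2 * s)" by (simp add: \<Gamma>_def)
        also have "\<dots> = (lP t - lU t) * ?i (P t) (E t)" unfolding RX s(1) using s(2) by simp
        finally show ?thesis by (simp add: PE algebra_simps)
      qed
      ultimately show ?thesis by simp
    qed
    \<comment> \<open>From \<open>R t \<ge> 8 * \<sigma> * (U t \<bullet> U t)\<close> and the bound
      \<open>\<kappa>\<close>. The factor \<open>U t \<bullet> U t\<close> in the latter absorbs a
      possible shrinking of the square.\<close>
    define \<gamma> where "\<gamma> = 4 * \<kappa> * \<sigma> / \<bar>s\<bar>"
    have \<gamma>pos: "\<gamma> > 0" using \<kappa>(1) \<sigma>pos s(2) by (simp add: \<gamma>_def)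
    have G: "(lP t - lU t) * R t / (2 * \<bar>s\<bar>) \<ge> \<gamma>" for t
    proof -
      have "R t = 4 * (?i (P t) (P t) + ?i (D t) (D t))"
        by (simp add: R_def sum_4 rsq body_simps plane_inner_simps DE[symmetric])
      then have "R t \<ge> 8 * \<sigma> * (U t \<bullet> U t)"
        using plane_inner_self_ge_0[of j k "P t"] by (simp add: \<sigma> DE_inner)
      then have "(lP t - lU t) * R t \<ge> (lP t - lU t) * (8 * \<sigma> * (U t \<bullet> U t))"
        using rates(1)[of t] by (simp add: mult_left_mono)
      also have "(lP t - lU t) * (8 * \<sigma> * (U t \<bullet> U t)) = 8 * \<sigma> * ((lP t - lU t) * (U t \<bullet> U t))" by simp
      also have "\<dots> \<ge> 8 * \<sigma> * \<kappa>" using \<kappa>(2)[of t] \<sigma>pos by (intro mult_left_mono) auto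
      finally have "8 * \<sigma> * \<kappa> / (2 * \<bar>s\<bar>) \<le> (lP t - lU t) * R t / (2 * \<bar>s\<bar>)"
        by (rule divide_right_mono) simp
      moreover have "8 * \<sigma> * \<kappa> / (2 * \<bar>s\<bar>) = \<gamma>" by (simp add: \<gamma>_def)
      ultimately show ?thesis by simp
    qed
    have \<Gamma>: "(\<forall>t. \<Gamma> t \<ge> \<gamma>) \<or> (\<forall>t. \<Gamma> t \<le> - \<gamma>)"
    proof (cases "s > 0")
      case True
      then show ?thesis using G by (simp add: \<Gamma>_def)
    next
      case False
      then have "\<Gamma> t = - ((lP t - lU t) * R t / (2 * \<bar>s\<bar>))" for t using s(2) by (simp add: \<Gamma>_def)
      then show ?thesis using G by simp
    qed
    \<comment> \<open>Bodies 1 and 3 keep a fixed angle difference and nonnegative radii, so the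
      cross product of their projections has a constant sign. It is \<open>-2\<close> times the
      cross product of \<open>P\<close> and \<open>D\<close>, which determines
      \<open>X\<close>.\<close>
    have Xs: "(\<forall>t. X t \<ge> 0) \<or> (\<forall>t. X t \<le> 0)"
    proof -
      define c where "c = \<epsilon> * sin (ang 3 - ang 1) * s"
      have "X t = c * (r 1 t * r 3 t / R t)" for t
      proof -
        have "?x (body 1 t) (body 3 t) = r 1 t * r 3 t * sin ((\<alpha> t + ang 3) - (\<alpha> t + ang 1))"
          unfolding plane_cross_def pj pk sin_diff by (simp add: algebra_simps)
        moreover have "?x (body 1 t) (body 3 t) = - 2 * ?x (P t) (D t)"
          by (simp add: body_simps plane_cross_simps plane_cross_skew[of j k "D t" "P t"])
        ultimately have x: "2 * ?x (P t) (D t) = - (r 1 t * r 3 t * sin (ang 3 - ang 1))" by simp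
        have "2 * ?i (P t) (E t) = - \<epsilon> * (2 * ?x (P t) (D t))" by (simp add: PE)
        then have "2 * ?i (P t) (E t) = \<epsilon> * (r 1 t * r 3 t * sin (ang 3 - ang 1))" unfolding x by simp
        then have "R t * X t = c * (r 1 t * r 3 t)" unfolding RX by (simp add: c_def s(1))
        then show ?thesis using Rpos[of t] by (simp add: field_simps)
      qed
      moreover have "r 1 t * r 3 t / R t \<ge> 0" for t using r Rpos[of t] by simp
      ultimately show ?thesis
        by (metis linorder_linear mult_nonneg_nonneg mult_nonpos_nonneg)
    qed
    have "X t = 0 \<and> - \<epsilon> * Y t = 0"
      by (rule rotation_one_signed_zero[OF dX dY \<Gamma> \<gamma>pos Xs])
    then have XY: "X t = 0" "Y t = 0" using \<epsilon>2 by auto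
    then have i0: "?i (P t) (E t) = 0" "?i (P t) (D t) = 0" using RX[of t] RY[of t] S0[of t] by auto
    then have "?x (P t) (D t) = 0" using PE[of t] \<epsilon>2 by auto
    then have "?i (P t) (P t) * ?i (D t) (D t) = 0"
      using plane_cross_sq[of j k "P t" "D t"] i0 by simp
    then show ?thesis using dpos[of t] by simp
  qed
  then show "(\<forall>t. ?i (D t) (D t) = 0) \<or> (\<forall>t. ?i (P t) (P t) = 0)"
    by (cases "\<sigma> = 0") (auto simp: \<sigma>)
qed

end

context orthogonal_central_triple
begin

text \<open>If \<open>P\<close> had a component in \<open>wx\<close>, the diagonals would have none
  and would turn in \<open>yz\<close>, a forbidden second rotation. So \<open>P\<close> lies in
  \<open>yz\<close>, where the projected diagonals are orthogonal to it, to each other and equally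
  long, which leaves only 0. Finally all bodies project to \<open>P\<close> in \<open>yz\<close>, so
  a turning \<open>P\<close> would again be a rotation there.\<close>

lemma elliptic_wx_only:
  assumes ell: "elliptic_rotation body 1 2" and nell: "\<not> elliptic_rotation body 3 4"
  shows "P t $ 1 = 0" "P t $ 2 = 0" "D t $ 3 = 0" "D t $ 4 = 0" "E t $ 3 = 0" "E t $ 4 = 0"
    and "plane_cross 3 4 (P t) (P' t) = 0"
proof -
  note proj = elliptic_projection[OF ell]
  have ip: "x \<bullet> y = plane_inner 1 2 x y + plane_inner 3 4 x y" for x y :: "real^4"
    by (simp add: inner_vec_def sum_4 plane_inner_def)
  have perp: "p = 0 \<and> p' = 0" if "p * x + p' * x' = 0" "p * y + p' * y' = 0" "x * y' - x' * y \<noteq> 0"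
    for p p' x x' y y' :: real
  proof -
    have "p * (x * y' - x' * y) = (p * x + p' * x') * y' - (p * y + p' * y') * x'"
      "p' * (x * y' - x' * y) = (p * y + p' * y') * x - (p * x + p' * x') * y" by (simp_all add: algebra_simps)
    then have "p * (x * y' - x' * y) = 0" "p' * (x * y' - x' * y) = 0" by (simp_all only: that(1,2))
    then show ?thesis using that(3) by simp
  qed
  have crossDD': "plane_cross j k (D t) (D' t) = - b t * plane_cross j k (D t) (E t)" for j k t
    by (simp add: D'_def plane_cross_simps)
  have P12: "\<forall>t. plane_inner 1 2 (P t) (P t) = 0"
  proof (rule ccontr)
    assume "\<not> ?thesis"
    then have "plane_inner 1 2 (D t) (D t) = 0" "plane_inner 1 2 (E t) (E t) = 0" for t
      using proj(4) proj(2)[of t] by auto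
    then have D0: "D t $ 1 = 0" "D t $ 2 = 0" and E0: "E t $ 1 = 0" "E t $ 2 = 0" for t
      by (simp_all add: plane_inner_self_eq_0)
    have DD: "D t \<bullet> D t = (D t $ 3)\<^sup>2 + (D t $ 4)\<^sup>2" "E t \<bullet> E t = (E t $ 3)\<^sup>2 + (E t $ 4)\<^sup>2"
      "D t $ 3 * E t $ 3 + D t $ 4 * E t $ 4 = 0" "P t $ 3 * D t $ 3 + P t $ 4 * D t $ 4 = 0"
      "P t $ 3 * E t $ 3 + P t $ 4 * E t $ 4 = 0" for t
      using DE_orth[of t] by (simp_all add: inner_vec_def sum_4 D0 E0 power2_eq_square)
    define \<epsilon> where "\<epsilon> = plane_cross 3 4 (D 0) (E 0) / (D 0 \<bullet> D 0)"
    have \<epsilon>: "plane_cross 3 4 (D t) (E t) = \<epsilon> * (D t \<bullet> D t)" for t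
      using cross_DE_ratio_const[of 3 4 t 0] DE_nonzero[of t] by (simp add: \<epsilon>_def field_simps)
    have E34: "E t $ 3 = - (\<epsilon> * D t $ 4)" "E t $ 4 = \<epsilon> * D t $ 3" for t
    proof -
      have "(D t \<bullet> D t) * E t $ 3 = - (D t $ 4 * (\<epsilon> * (D t \<bullet> D t)))"
        "(D t \<bullet> D t) * E t $ 4 = D t $ 3 * (\<epsilon> * (D t \<bullet> D t))"
        unfolding \<epsilon>[symmetric] unfolding DD(1) plane_cross_def using DD(3)[of t] by algebra+
      moreover have "- (y * (\<epsilon> * N)) = N * - (\<epsilon> * y)" "y * (\<epsilon> * N) = N * (\<epsilon> * y)" for y N :: real
        by simp_all
      ultimately have "(D t \<bullet> D t) * E t $ 3 = (D t \<bullet> D t) * - (\<epsilon> * D t $ 4)"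
        "(D t \<bullet> D t) * E t $ 4 = (D t \<bullet> D t) * (\<epsilon> * D t $ 3)" by (simp_all only:)
      then show "E t $ 3 = - (\<epsilon> * D t $ 4)" "E t $ 4 = \<epsilon> * D t $ 3"
        using DE_nonzero(1)[of t] by (metis inner_eq_zero_iff mult_left_cancel)+
    qed
    have "(D 0 \<bullet> D 0) * \<epsilon>\<^sup>2 = E 0 \<bullet> E 0" unfolding DD E34 by (simp add: algebra_simps power_mult_distrib)
    then have "\<epsilon>\<^sup>2 = 1" using DE_inner(2)[of 0] DE_nonzero[of 0] by simp
    then have \<epsilon>1: "\<epsilon> = 1 \<or> \<epsilon> = - 1" by (simp add: power2_eq_1_iff)
    have cr: "plane_cross 3 4 (D t) (E t) \<noteq> 0" for t using \<epsilon>1 DE_nonzero[of t] by (auto simp: \<epsilon>)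
    have P34: "P t $ 3 = 0" "P t $ 4 = 0" for t
      using perp[OF DD(4,5)[of t]] cr[of t] by (auto simp: plane_cross_def mult.commute)
    have "plane_cross 3 4 (D 0) (D' 0) \<noteq> 0" using cr b_nonzero by (simp add: crossDD')
    then have rot: "D 0 $ 3 * D' 0 $ 4 - D 0 $ 4 * D' 0 $ 3 \<noteq> 0" by (simp add: plane_cross_def)
    have nz: "(D t $ 3)\<^sup>2 + (D t $ 4)\<^sup>2 \<noteq> 0" for t using DE_nonzero[of t] unfolding DD(1)[symmetric] by simp
    obtain \<beta> where \<beta>: "continuous_on UNIV \<beta>" "\<not> \<beta> constant_on UNIV"
      "\<And>t. D t $ 3 = sqrt ((D t $ 3)\<^sup>2 + (D t $ 4)\<^sup>2) * cos (\<beta> t)"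
      "\<And>t. D t $ 4 = sqrt ((D t $ 3)\<^sup>2 + (D t $ 4)\<^sup>2) * sin (\<beta> t)"
      using polar_angle_nonconstant[where x = "\<lambda>t. D t $ 3" and y = "\<lambda>t. D t $ 4",
        OF has_real_derivative_nth[OF dD(1)] has_real_derivative_nth[OF dD(1)] nz rot] by blast
    define \<rho> where "\<rho> t = sqrt ((D t $ 3)\<^sup>2 + (D t $ 4)\<^sup>2)" for t
    have D34: "D t $ 3 = \<rho> t * cos (\<beta> t)" "D t $ 4 = \<rho> t * sin (\<beta> t)" for t
      using \<beta>(3,4) by (simp_all add: \<rho>_def)
    \<comment> \<open>In this case \<open>P\<close> vanishes in \<open>yz\<close>, so the bodies
      project to a centred square whose successive corners differ by quarter turns in the direction
      \<open>\<epsilon>\<close>.\<close>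
    define ang where "ang = (\<lambda>i::4. if i = 1 then 0 else if i = 2 then \<epsilon> * (pi / 2) else if i = 3 then pi else - \<epsilon> * (pi / 2))"
    have "\<rho> t \<ge> 0 \<and> body i t $ 3 = \<rho> t * cos (\<beta> t + ang i) \<and> body i t $ 4 = \<rho> t * sin (\<beta> t + ang i)" for i t
    proof -
      have "\<rho> t \<ge> 0" by (simp add: \<rho>_def)
      moreover have "body i t $ 3 = \<rho> t * cos (\<beta> t + ang i) \<and> body i t $ 4 = \<rho> t * sin (\<beta> t + ang i)"
        using exhaust_4[of i] \<epsilon>1
        by (elim disjE) (simp_all add: body_simps ang_def P34 E34 D34 cos_add sin_add cos_diff sin_diff)
      ultimately show ?thesis by simp
    qed
    then have "elliptic_rotation body 3 4"
      unfolding elliptic_rotation_def using \<beta>(1,2)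
      by (intro exI[of _ \<beta>] exI[of _ ang] exI[of _ "\<lambda>_. \<rho>"]) auto
    then show False using nell by simp
  qed
  then show P0: "P t $ 1 = 0" "P t $ 2 = 0" for t by (simp_all add: plane_inner_self_eq_0)
  have "D t $ 3 = 0 \<and> D t $ 4 = 0 \<and> E t $ 3 = 0 \<and> E t $ 4 = 0" for t
  proof -
    have P12: "plane_inner 1 2 (P t) x = 0" for x by (simp add: plane_inner_def P0)
    have o: "plane_inner 3 4 (P t) (D t) = 0" "plane_inner 3 4 (P t) (E t) = 0" "plane_inner 3 4 (D t) (E t) = 0"
      "plane_inner 3 4 (D t) (D t) = plane_inner 3 4 (E t) (E t)" "plane_inner 3 4 (P t) (P t) \<noteq> 0"
      using DE_orth[of t] DE_inner(2)[of t] nonzero(1)[of t] proj(2,3)[of t]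
        ip[of "P t" "D t"] ip[of "P t" "E t"] ip[of "D t" "E t"] ip[of "D t" "D t"] ip[of "E t" "E t"]
        ip[of "P t" "P t"] P12 by auto
    have "plane_cross 3 4 (D t) (E t) = 0"
      using perp[of "P t $ 3" "D t $ 3" "P t $ 4" "D t $ 4" "E t $ 3" "E t $ 4"] o
      by (auto simp: plane_inner_def plane_cross_def mult.commute)
    then have "plane_inner 3 4 (D t) (D t) = 0"
      using plane_cross_sq[of 3 4 "D t" "E t"] o by simp
    then show ?thesis using o(4) by (simp add: plane_inner_self_eq_0[symmetric])
  qed
  then show DE0: "D t $ 3 = 0" "D t $ 4 = 0" "E t $ 3 = 0" "E t $ 4 = 0" for t by simp_all
  show "plane_cross 3 4 (P t) (P' t) = 0"
  proof (rule ccontr)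
    assume "\<not> ?thesis"
    then have rot: "P t $ 3 * P' t $ 4 - P t $ 4 * P' t $ 3 \<noteq> 0" by (simp add: plane_cross_def)
    have nz: "(P t $ 3)\<^sup>2 + (P t $ 4)\<^sup>2 \<noteq> 0" for t
      using inner_eq_zero_iff[of "P t"] nonzero(1)[of t] by (simp add: inner_vec_def sum_4 P0 power2_eq_square)
    obtain \<beta> where \<beta>: "continuous_on UNIV \<beta>" "\<not> \<beta> constant_on UNIV"
      "\<And>t. P t $ 3 = sqrt ((P t $ 3)\<^sup>2 + (P t $ 4)\<^sup>2) * cos (\<beta> t)"
      "\<And>t. P t $ 4 = sqrt ((P t $ 3)\<^sup>2 + (P t $ 4)\<^sup>2) * sin (\<beta> t)"
      using polar_angle_nonconstant[where x = "\<lambda>t. P t $ 3" and y = "\<lambda>t. P t $ 4",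
        OF has_real_derivative_nth[OF dP(1)] has_real_derivative_nth[OF dP(1)] nz rot] by blast
    define \<rho> where "\<rho> t = sqrt ((P t $ 3)\<^sup>2 + (P t $ 4)\<^sup>2)" for t
    have P34: "P t $ 3 = \<rho> t * cos (\<beta> t)" "P t $ 4 = \<rho> t * sin (\<beta> t)" for t
      using \<beta>(3,4) by (simp_all add: \<rho>_def)
    have "\<rho> t \<ge> 0 \<and> body i t $ 3 = \<rho> t * cos (\<beta> t + 0) \<and> body i t $ 4 = \<rho> t * sin (\<beta> t + 0)" for i t
    proof -
      have "\<rho> t \<ge> 0" by (simp add: \<rho>_def)
      moreover have "body i t $ 3 = \<rho> t * cos (\<beta> t + 0) \<and> body i t $ 4 = \<rho> t * sin (\<beta> t + 0)"
        using exhaust_4[of i] by (elim disjE) (simp_all add: body_simps DE0 P34)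
      ultimately show ?thesis by simp
    qed
    then have "elliptic_rotation body 3 4"
      unfolding elliptic_rotation_def using \<beta>(1,2)
      by (intro exI[of _ \<beta>] exI[of _ "\<lambda>_. 0"] exI[of _ "\<lambda>_. \<rho>"]) auto
    then show False using nell by simp
  qed
qed

lemma elliptic_momentum:
  fixes t :: real
  assumes ell: "elliptic_rotation body 1 2" and nell: "\<not> elliptic_rotation body 3 4"
  defines "c \<equiv> \<lambda>j k. (\<Sum>i\<in>UNIV. plane_cross j k (body i t) (vel i t))"
  shows "c 1 2 \<noteq> 0 \<and> c 1 3 = 0 \<and> c 1 4 = 0 \<and> c 2 3 = 0 \<and> c 2 4 = 0 \<and> c 3 4 = 0"
proof -
  note z = elliptic_wx_only[OF ell nell]
  have P'0: "P' t $ 1 = 0" "P' t $ 2 = 0" by (rule P_coordinates_zero; rule z)+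
  have D'0: "D' t $ 3 = 0" "D' t $ 4 = 0" "E' t $ 3 = 0" "E' t $ 4 = 0"
    by (simp_all add: D'_def E'_def z)
  have "c 1 2 \<noteq> 0" unfolding c_def by (rule elliptic_projection(1)[OF ell]) simp
  moreover have "c 1 3 = 0 \<and> c 1 4 = 0 \<and> c 2 3 = 0 \<and> c 2 4 = 0"
    unfolding c_def sum_cross by (simp add: plane_cross_def z P'0 D'0)
  moreover have "c 3 4 = 0"
    unfolding c_def sum_cross using z(7) by (simp add: plane_cross_def z D'0)
  ultimately show ?thesis by simp
qed

end

section \<open>Rectangular rotopulsators\<close>

text \<open>The common squared length \<open>K\<close> is left free because the lemma serves twice:
  for the positions with \<open>K = 1\<close>, and for the velocities, which also satisfy the
  parallelogram relation and have equal lengths.\<close>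

lemma rectangle_inner:
  fixes x1 x2 x3 x4 :: "'a::real_inner"
  assumes d: "x1 + x3 = x2 + x4" and n: "x1 \<bullet> x1 = K" "x2 \<bullet> x2 = K" "x3 \<bullet> x3 = K" "x4 \<bullet> x4 = K"
  shows "x3 \<bullet> x4 = x1 \<bullet> x2" "x2 \<bullet> x3 = x1 \<bullet> x4" "x2 \<bullet> x4 = x1 \<bullet> x3" "x1 \<bullet> x2 + x1 \<bullet> x4 = K + x1 \<bullet> x3"
    and "(x1 + x3) \<bullet> (x1 - x2) = 0" "(x1 + x3) \<bullet> (x1 - x4) = 0" "(x1 - x2) \<bullet> (x1 - x4) = 0"
proof -
  have x4: "x4 = x1 + x3 - x2" using d by (simp add: algebra_simps)
  have "x1 \<bullet> x2 + x2 \<bullet> x3 = K + x1 \<bullet> x3"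
    using n unfolding x4 by (simp add: inner_add_left inner_add_right inner_diff_left inner_diff_right inner_commute)
  then show "x3 \<bullet> x4 = x1 \<bullet> x2" "x2 \<bullet> x3 = x1 \<bullet> x4" "x2 \<bullet> x4 = x1 \<bullet> x3" "x1 \<bullet> x2 + x1 \<bullet> x4 = K + x1 \<bullet> x3"
    "(x1 + x3) \<bullet> (x1 - x2) = 0" "(x1 + x3) \<bullet> (x1 - x4) = 0" "(x1 - x2) \<bullet> (x1 - x4) = 0"
    using n unfolding x4 by (simp_all add: inner_add_left inner_add_right inner_diff_left inner_diff_right inner_commute)
qed

text \<open>The coefficient of attraction between two bodies at distance \<open>arccos x\<close>. It
  is even in \<open>x\<close> and grows both towards collisions and towards antipodal positions, so
  comparisons go through squares.\<close>

definition pair_strength :: "real \<Rightarrow> real \<Rightarrow> real" where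
  "pair_strength \<mu> x = \<mu> / (1 - x\<^sup>2) powr (3 / 2)"

lemma pair_strength_pos: "\<mu> > 0 \<Longrightarrow> x\<^sup>2 < 1 \<Longrightarrow> pair_strength \<mu> x > 0"
  by (simp add: pair_strength_def)

lemma pair_strength_mono:
  assumes "\<mu> > 0" "x\<^sup>2 < y\<^sup>2" "y\<^sup>2 < 1"
  shows "pair_strength \<mu> x < pair_strength \<mu> y"
  unfolding pair_strength_def using assms
  by (intro divide_strict_left_mono powr_less_mono2 mult_pos_pos) auto

text \<open>The power 3/2 of a number below 1 is at most the number itself, here
  \<open>(1 - x) * (1 + x)\<close>, and \<open>1 + x\<close> is below 2. With \<open>x\<close> the
  cosine of a side this yields the constant \<open>\<mu> / 2\<close> taken for
  \<open>\<kappa>\<close>.\<close>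

lemma pair_strength_lower:
  assumes "\<mu> > 0" "x\<^sup>2 < 1"
  shows "pair_strength \<mu> x * (1 - x) \<ge> \<mu> / 2"
proof -
  have x: "x < 1" "- 1 < x" using assms(2) by (auto simp: power2_less_1_iff abs_less_iff)
  have "(1 - x\<^sup>2) powr (3 / 2) \<le> (1 - x\<^sup>2) powr 1" using assms(2) by (intro powr_mono') auto
  also have "\<dots> = (1 - x) * (1 + x)" using assms(2) by (simp add: algebra_simps power2_eq_square)
  also have "\<dots> \<le> (1 - x) * 2" using x by (intro mult_left_mono) auto
  finally have "\<mu> / ((1 - x) * 2) \<le> pair_strength \<mu> x"
    unfolding pair_strength_def using assms x by (intro divide_left_mono mult_pos_pos) auto
  then have "\<mu> / ((1 - x) * 2) * (1 - x) \<le> pair_strength \<mu> x * (1 - x)" using x by (intro mult_right_mono) auto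
  moreover have "\<mu> / (y * 2) * y = \<mu> / 2" if "y > 0" for y using that by simp
  from this[of "1 - x"] have "\<mu> / ((1 - x) * 2) * (1 - x) = \<mu> / 2" using x by linarith
  ultimately show ?thesis by (simp only:)
qed

text \<open>If one argument is negative, the other is larger in absolute value and so has the
  greater strength. For the cosines of the two sides of the rectangle, whose sum is positive, this
  makes the rates of \<open>U\<close> and \<open>V\<close> have negative sum.\<close>

lemma pair_strength_weighted:
  assumes "\<mu> > 0" "x\<^sup>2 < 1" "y\<^sup>2 < 1" "x + y > 0"
  shows "x * pair_strength \<mu> x + y * pair_strength \<mu> y > 0"
proof -
  have main: "x * pair_strength \<mu> x + y * pair_strength \<mu> y > 0"
    if "x\<^sup>2 < 1" "y\<^sup>2 < 1" "x + y > 0" "y \<le> x" for x y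
  proof (cases "y \<ge> 0")
    case True
    then show ?thesis using that assms(1) pair_strength_pos[of \<mu> x] pair_strength_pos[of \<mu> y]
      by (intro add_pos_nonneg) (auto intro: mult_pos_pos mult_nonneg_nonneg less_imp_le)
  next
    case False
    then have "y\<^sup>2 < x\<^sup>2" using that(3) power_strict_mono[of "- y" x 2] by simp
    then have "pair_strength \<mu> y < pair_strength \<mu> x" using pair_strength_mono assms(1) that(1) by blast
    then have "- y * pair_strength \<mu> y < x * pair_strength \<mu> x"
      using False that(3) pair_strength_pos[OF assms(1) that(2)]
      by (intro mult_strict_mono) auto
    then show ?thesis by simp
  qed
  show ?thesis
    using main[of x y] main[of y x] assms by (cases "y \<le> x") (auto simp: add.commute)
qed

theorem theorem3:
  fixes \<mu> :: real
    and m :: "4 \<Rightarrow> real"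
    and q v :: "4 \<Rightarrow> real \<Rightarrow> real ^ 4"
  assumes "\<mu> > 0"
    and "\<And>i. m i = \<mu>"
    and "spherical_rectangular_rotopulsator m q v"
  shows "spherical_square_rotopulsator m q v \<and>
    (\<forall>t. let c = angular_momentum m (\<lambda>i. q i t) (\<lambda>i. v i t) in
       c 1 2 \<noteq> 0 \<and> c 1 3 = 0 \<and> c 1 4 = 0 \<and> c 2 3 = 0 \<and> c 2 4 = 0 \<and> c 3 4 = 0)"
proof -
  have m: "m = (\<lambda>_. \<mu>)" using assms(2) by blast
  have pos: "positive_elliptic_rotopulsator m q v" and rect: "\<And>t. spherical_rectangle (\<lambda>i. q i t)"
    using assms(3) by (auto simp: spherical_rectangular_rotopulsator_def)
  have unit: "q i t \<bullet> q i t = 1" for i t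
    using pos by (simp add: positive_elliptic_rotopulsator_def norm_eq_1)
  have ell: "elliptic_rotation q 1 2" and nell: "\<not> elliptic_rotation q 3 4"
    using pos by (auto simp: positive_elliptic_rotopulsator_def)
  define acc where "acc i t = curved_force m (\<lambda>j. q j t) i - (v i t \<bullet> v i t) *\<^sub>R q i t" for i t
  have nc: "\<And>t i j. i \<noteq> j \<Longrightarrow> (q i t \<bullet> q j t)\<^sup>2 \<noteq> 1"
    and dq: "\<And>t i. (q i has_vector_derivative v i t) (at t)"
    and dv: "\<And>t i. (v i has_vector_derivative acc i t) (at t)"
    using pos unfolding positive_elliptic_rotopulsator_def curved_4body_solution_def acc_def by auto
  have lt: "(q i t \<bullet> q j t)\<^sup>2 < 1" if "i \<noteq> j" for i j t
    using Cauchy_Schwarz_ineq[of "q i t" "q j t"] nc[OF that, of t] by (simp add: unit)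
  have diag: "q 1 t + q 3 t = q 2 t + q 4 t" for t
    using spherical_rectangle_diagonals[OF rect[of t] nc] .
  have deriv_zero: "x = 0" if "\<And>s. f s = 0" "(f has_vector_derivative x) (at t)" for f :: "real \<Rightarrow> real^4" and x t
  proof -
    have "f = (\<lambda>_. 0)" using that(1) by blast
    then show ?thesis using vector_derivative_unique_at[OF that(2)] has_vector_derivative_const[of 0 "at t"] by simp
  qed
  have vdiag: "v 1 t + v 3 t = v 2 t + v 4 t" for t
    using deriv_zero[OF _ has_vector_derivative_diff[OF has_vector_derivative_add[OF dq[of 1] dq[of 3]]
        has_vector_derivative_add[OF dq[of 2] dq[of 4]]]] by (simp add: diag)
  have adiag: "acc 1 t + acc 3 t = acc 2 t + acc 4 t" for t
    using deriv_zero[OF _ has_vector_derivative_diff[OF has_vector_derivative_add[OF dv[of 1] dv[of 3]]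
        has_vector_derivative_add[OF dv[of 2] dv[of 4]]]] by (simp add: vdiag)
  define P U V where "P t = (1/2) *\<^sub>R (q 1 t + q 3 t)" and "U t = (1/2) *\<^sub>R (q 1 t - q 2 t)"
    and "V t = (1/2) *\<^sub>R (q 1 t - q 4 t)" for t
  define P' U' V' where "P' t = (1/2) *\<^sub>R (v 1 t + v 3 t)" and "U' t = (1/2) *\<^sub>R (v 1 t - v 2 t)"
    and "V' t = (1/2) *\<^sub>R (v 1 t - v 4 t)" for t
  note rq = rectangle_inner[OF diag unit unit unit unit]
  define a b c where "a t = q 1 t \<bullet> q 2 t" and "b t = q 1 t \<bullet> q 4 t" and "c t = q 1 t \<bullet> q 3 t" for t
  have ips: "q 1 t \<bullet> q 2 t = a t" "q 2 t \<bullet> q 1 t = a t" "q 3 t \<bullet> q 4 t = a t" "q 4 t \<bullet> q 3 t = a t"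
    "q 1 t \<bullet> q 4 t = b t" "q 4 t \<bullet> q 1 t = b t" "q 2 t \<bullet> q 3 t = b t" "q 3 t \<bullet> q 2 t = b t"
    "q 1 t \<bullet> q 3 t = c t" "q 3 t \<bullet> q 1 t = c t" "q 2 t \<bullet> q 4 t = c t" "q 4 t \<bullet> q 2 t = c t" for t
    using rq(1-3)[of t] by (simp_all add: a_def b_def c_def inner_commute)
  have abc: "a t + b t = 1 + c t" for t using rq(4)[of t] by (simp add: ips)
  have abc1: "(a t)\<^sup>2 < 1" "(b t)\<^sup>2 < 1" "(c t)\<^sup>2 < 1" for t
    using lt[of 1 2 t] lt[of 1 4 t] lt[of 1 3 t] by (simp_all add: ips)
  then have abc2: "- 1 < a t" "a t < 1" "- 1 < b t" "b t < 1" "- 1 < c t" "c t < 1" for t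
    by (simp_all add: power2_less_1_iff abs_less_iff)
  have PUV: "P t \<bullet> P t = (1 + c t) / 2" "U t \<bullet> U t = (1 - a t) / 2" "V t \<bullet> V t = (1 - b t) / 2" for t
    by (simp_all add: P_def U_def V_def inner_add_left inner_add_right inner_diff_left inner_diff_right ips unit field_simps)
  have nonzero: "P t \<noteq> 0" "U t \<noteq> 0" "V t \<noteq> 0" for t
    using PUV[of t] abc2[of t] by auto
  have orth: "P t \<bullet> U t = 0" "P t \<bullet> V t = 0" "U t \<bullet> V t = 0" for t
    using rq(5-7)[of t] by (simp_all add: P_def U_def V_def)
  have qs: "q 1 t = P t + U t + V t" "q 2 t = P t - U t + V t" "q 3 t = P t - U t - V t" "q 4 t = P t + U t - V t" for t
  proof -
    have q4: "q 4 t = q 1 t + q 3 t - q 2 t" using diag[of t] by (simp add: algebra_simps)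
    show "q 1 t = P t + U t + V t" "q 2 t = P t - U t + V t" "q 3 t = P t - U t - V t" "q 4 t = P t + U t - V t"
      unfolding P_def U_def V_def q4 by (simp_all add: vec_eq_iff field_simps)
  qed
  define fa fb fc where "fa t = pair_strength \<mu> (a t)" and "fb t = pair_strength \<mu> (b t)"
    and "fc t = pair_strength \<mu> (c t)" for t
  have fpos: "fa t > 0" "fb t > 0" "fc t > 0" for t
    using pair_strength_pos[OF assms(1)] abc1 by (simp_all add: fa_def fb_def fc_def)
  have compl: "UNIV - {1} = {2, 3, 4::4}" "UNIV - {2} = {1, 3, 4::4}" "UNIV - {3} = {1, 2, 4::4}"
    "UNIV - {4} = {1, 2, 3::4}"
    unfolding UNIV_4 by auto
  have force: "curved_force m (\<lambda>j. q j t) 1 = fa t *\<^sub>R (q 2 t - a t *\<^sub>R q 1 t) + fc t *\<^sub>R (q 3 t - c t *\<^sub>R q 1 t) + fb t *\<^sub>R (q 4 t - b t *\<^sub>R q 1 t)"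
    "curved_force m (\<lambda>j. q j t) 2 = fa t *\<^sub>R (q 1 t - a t *\<^sub>R q 2 t) + fb t *\<^sub>R (q 3 t - b t *\<^sub>R q 2 t) + fc t *\<^sub>R (q 4 t - c t *\<^sub>R q 2 t)"
    "curved_force m (\<lambda>j. q j t) 3 = fc t *\<^sub>R (q 1 t - c t *\<^sub>R q 3 t) + fb t *\<^sub>R (q 2 t - b t *\<^sub>R q 3 t) + fa t *\<^sub>R (q 4 t - a t *\<^sub>R q 3 t)"
    "curved_force m (\<lambda>j. q j t) 4 = fb t *\<^sub>R (q 1 t - b t *\<^sub>R q 4 t) + fc t *\<^sub>R (q 2 t - c t *\<^sub>R q 4 t) + fa t *\<^sub>R (q 3 t - a t *\<^sub>R q 4 t)" for t
    unfolding curved_force_def compl tangent_part_def m pair_strength_def[symmetric] fa_def fb_def fc_def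
    by (simp_all add: ips add.assoc)
  define K where "K i t = v i t \<bullet> v i t" for i t
  \<comment> \<open>The coefficients of the force on body 1 along \<open>P\<close>,
    \<open>U\<close>, \<open>V\<close>. By the symmetry of the rectangle the other bodies have the
    same ones up to sign.\<close>
  define eP eU eV where "eP t = fa t * (1 - a t) + fc t * (1 - c t) + fb t * (1 - b t)"
    and "eU t = - fa t * (1 + a t) - fc t * (1 + c t) + fb t * (1 - b t)"
    and "eV t = fa t * (1 - a t) - fc t * (1 + c t) - fb t * (1 + b t)" for t
  have forceP: "curved_force m (\<lambda>j. q j t) 1 = eP t *\<^sub>R P t + eU t *\<^sub>R U t + eV t *\<^sub>R V t"
    "curved_force m (\<lambda>j. q j t) 2 = eP t *\<^sub>R P t - eU t *\<^sub>R U t + eV t *\<^sub>R V t"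
    "curved_force m (\<lambda>j. q j t) 3 = eP t *\<^sub>R P t - eU t *\<^sub>R U t - eV t *\<^sub>R V t"
    "curved_force m (\<lambda>j. q j t) 4 = eP t *\<^sub>R P t + eU t *\<^sub>R U t - eV t *\<^sub>R V t" for t
    unfolding force qs eP_def eU_def eV_def by (simp_all add: algebra_simps)
  \<comment> \<open>In the alternating sum of the accelerations the forces cancel. Only the speed
    terms remain, and \<open>P\<close>, \<open>U\<close>, \<open>V\<close> are independent.\<close>
  have Keq: "K 2 t = K 1 t \<and> K 3 t = K 1 t \<and> K 4 t = K 1 t" for t
  proof -
    define k1 k2 k3 where "k1 = K 1 t - K 2 t + K 3 t - K 4 t" and "k2 = K 1 t + K 2 t - K 3 t - K 4 t"
      and "k3 = K 1 t - K 2 t - K 3 t + K 4 t"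
    have z: "k1 *\<^sub>R P t + k2 *\<^sub>R U t + k3 *\<^sub>R V t = 0"
      using adiag[of t] unfolding acc_def forceP K_def[symmetric] k1_def k2_def k3_def qs
      by (simp add: algebra_simps)
    have "k1 = 0" "k2 = 0" "k3 = 0"
      using arg_cong[OF z, of "\<lambda>x. P t \<bullet> x"] arg_cong[OF z, of "\<lambda>x. U t \<bullet> x"] arg_cong[OF z, of "\<lambda>x. V t \<bullet> x"]
        nonzero[of t] orth[of t] orth[of t, THEN trans[OF inner_commute]]
      by (simp_all only: inner_add_right inner_scaleR_right) simp_all
    then show ?thesis unfolding k1_def k2_def k3_def by linarith
  qed
  then have vn: "v 1 t \<bullet> v 1 t = K 1 t" "v 2 t \<bullet> v 2 t = K 1 t" "v 3 t \<bullet> v 3 t = K 1 t" "v 4 t \<bullet> v 4 t = K 1 t" for t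
    unfolding K_def by auto
  note rv = rectangle_inner[OF vdiag vn]
  have acc: "acc 1 t = (eP t - K 1 t) *\<^sub>R P t + (eU t - K 1 t) *\<^sub>R U t + (eV t - K 1 t) *\<^sub>R V t"
    "acc 2 t = (eP t - K 1 t) *\<^sub>R P t - (eU t - K 1 t) *\<^sub>R U t + (eV t - K 1 t) *\<^sub>R V t"
    "acc 3 t = (eP t - K 1 t) *\<^sub>R P t - (eU t - K 1 t) *\<^sub>R U t - (eV t - K 1 t) *\<^sub>R V t"
    "acc 4 t = (eP t - K 1 t) *\<^sub>R P t + (eU t - K 1 t) *\<^sub>R U t - (eV t - K 1 t) *\<^sub>R V t" for t
    unfolding acc_def vn forceP qs by (simp_all add: algebra_simps)
  have mean_acc: "(1/2) *\<^sub>R (acc 1 t + acc 3 t) = (eP t - K 1 t) *\<^sub>R P t"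
    "(1/2) *\<^sub>R (acc 1 t - acc 2 t) = (eU t - K 1 t) *\<^sub>R U t"
    "(1/2) *\<^sub>R (acc 1 t - acc 4 t) = (eV t - K 1 t) *\<^sub>R V t" for t
    unfolding acc by (simp_all add: vec_eq_iff)
  interpret orthogonal_central_triple P U V P' U' V' "\<lambda>t. eP t - K 1 t" "\<lambda>t. eU t - K 1 t" "\<lambda>t. eV t - K 1 t" "\<mu> / 2"
  proof
    fix t
    show "(P has_vector_derivative P' t) (at t)" "(U has_vector_derivative U' t) (at t)" "(V has_vector_derivative V' t) (at t)"
      unfolding P_def[abs_def] U_def[abs_def] V_def[abs_def] P'_def U'_def V'_def
      by (intro bounded_linear.has_vector_derivative[OF bounded_linear_scaleR_right] has_vector_derivative_add has_vector_derivative_diff dq)+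
    have "(P' has_vector_derivative (1/2) *\<^sub>R (acc 1 t + acc 3 t)) (at t)"
      "(U' has_vector_derivative (1/2) *\<^sub>R (acc 1 t - acc 2 t)) (at t)"
      "(V' has_vector_derivative (1/2) *\<^sub>R (acc 1 t - acc 4 t)) (at t)"
      unfolding P'_def[abs_def] U'_def[abs_def] V'_def[abs_def]
      by (intro bounded_linear.has_vector_derivative[OF bounded_linear_scaleR_right] has_vector_derivative_add has_vector_derivative_diff dv)+
    then show "(P' has_vector_derivative (eP t - K 1 t) *\<^sub>R P t) (at t)"
      "(U' has_vector_derivative (eU t - K 1 t) *\<^sub>R U t) (at t)"
      "(V' has_vector_derivative (eV t - K 1 t) *\<^sub>R V t) (at t)"
      unfolding mean_acc .
    show "P' t \<bullet> U' t = 0" "P' t \<bullet> V' t = 0" "U' t \<bullet> V' t = 0"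
      using rv(5-7)[of t] by (simp_all add: P'_def U'_def V'_def)
    show "P t \<bullet> P t + U t \<bullet> U t + V t \<bullet> V t = 1"
      using abc[of t] unfolding PUV by (simp add: field_simps)
    have dPU: "eP t - eU t = 2 * fa t + 2 * fc t" and dPV: "eP t - eV t = 2 * fb t + 2 * fc t"
      and dUV: "eU t - eV t = 2 * (fb t - fa t)"
      and sUV: "eU t + eV t = - 2 * (a t * fa t + b t * fb t) - 2 * (fc t * (1 + c t))"
      by (simp_all add: eP_def eU_def eV_def algebra_simps)
    show "eU t - K 1 t < eP t - K 1 t" "eV t - K 1 t < eP t - K 1 t"
      using dPU dPV fpos[of t] by linarith+
    have neg: "- 2 * x - 2 * y < 0" if "x > 0" "y > 0" for x y :: real
      using that by linarith
    have "a t * fa t + b t * fb t > 0" unfolding fa_def fb_def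
      using abc[of t] abc1[of t] abc2[of t] assms(1) by (intro pair_strength_weighted) auto
    moreover have "fc t * (1 + c t) > 0" using fpos[of t] abc2[of t] by simp
    ultimately have "eU t + eV t < 0" unfolding sUV by (rule neg)
    moreover have "K 1 t \<ge> 0" by (simp add: K_def)
    ultimately show "eU t - K 1 t + (eV t - K 1 t) < 0" by linarith
    show "U t \<bullet> U t = V t \<bullet> V t" if "eU t - K 1 t = eV t - K 1 t"
    proof -
      have "fa t = fb t" using that dUV by simp
      then have "(a t)\<^sup>2 = (b t)\<^sup>2"
        using pair_strength_mono[OF assms(1), of "a t" "b t"] pair_strength_mono[OF assms(1), of "b t" "a t"] abc1[of t]
        unfolding fa_def fb_def by linarith
      \<comment> \<open>The strength sees only squares. The wrong sign is excluded by
        \<open>a t + b t = 1 + c t\<close>, which is positive because opposite vertices are not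
        antipodal.\<close>
      moreover have "a t \<noteq> - b t" using abc[of t] abc2[of t] by linarith
      ultimately have "a t = b t" by (simp add: power2_eq_iff)
      then show ?thesis by (simp add: PUV)
    qed
    show "\<mu> / 2 > 0" using assms(1) by simp
    have "\<mu> / 2 \<le> fa t * (1 - a t)" unfolding fa_def by (rule pair_strength_lower[OF assms(1) abc1(1)])
    also have "\<dots> \<le> (fa t + fc t) * (1 - a t)" using fpos[of t] abc2[of t] by (intro mult_right_mono) auto
    also have "\<dots> = (eP t - K 1 t - (eU t - K 1 t)) * (U t \<bullet> U t)" using dPU by (simp add: PUV)
    finally show "\<mu> / 2 \<le> (eP t - K 1 t - (eU t - K 1 t)) * (U t \<bullet> U t)" .
  qed (fact orth nonzero)+
  have body_eq: "body i t = q i t" for i t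
    using exhaust_4[of i] qs[of t] by (auto simp: body_simps D_def E_def algebra_simps)
  then have body_eq': "body = q" by blast
  have vel_eq: "vel i t = v i t" for i t
    using vector_derivative_unique_at[OF body_deriv[of i t, unfolded body_eq'] dq] .
  have "spherical_square (\<lambda>i. q i t)" for t
  proof -
    have "a t = b t" using square[of t] by (simp add: PUV)
    moreover have five: "(5::4) = 1" by simp
    ultimately have "q i t \<bullet> q (i + 1) t = a t" for i using exhaust_4[of i] by (auto simp: ips five)
    then have "equilateral (\<lambda>i. q i t)" by (simp add: equilateral_def spherical_dist_def)
    then show ?thesis using rect[of t] by (simp add: spherical_square_def spherical_rectangle_def)
  qed
  then have "spherical_square_rotopulsator m q v" using pos by (simp add: spherical_square_rotopulsator_def)
  moreover have "angular_momentum m (\<lambda>i. q i t) (\<lambda>i. v i t) j k =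
      \<mu> * (\<Sum>i\<in>UNIV. plane_cross j k (body i t) (vel i t))" for t j k
    by (simp add: angular_momentum_def m sum_distrib_left body_eq vel_eq plane_cross_def)
  ultimately show ?thesis
    using elliptic_momentum[unfolded body_eq', OF ell nell] assms(1) by (simp add: body_eq Let_def)
qed

end
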